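(* Let $(M,g)$, $M=\mathbb{R}\times S$, be an SOM-spacetime with Fermat metric $F$, pre-distance $d_F$ and symmetrized pre-distance $d_s$. Then: (C1) the following are equivalent: $(M,g)$ is totally vicious; there exists a closed curve $\gamma$ in $S$ with $\ell_F(\gamma)<0$; there exists $x\in S$ with $d_F(x,x)<0$. In this case $d_F\equiv-\infty$. (C2) the following are equivalent: $(M,g)$ is chronological; $d_F(x,x)=0$ for some $x\in S$; $d_F(x,x)=0$ for all $x\in S$; $d_s(x,y)\ge0$ for every $x,y\in S$.
   Context: An SOM-spacetime is a product $M=\mathbb{R}\times S$ ($S$ a connected smooth manifold) with the Lorentzian metric $g=-\beta\,dt\otimes dt+dt\otimes\omega+\omega\otimes dt+g_0$, where $\beta:S\to(0,\infty)$ is a smooth function, $\omega$ a one-form on $S$, $g_0$ a symmetric $(0,2)$-tensor on $S$, and $g_0(v,v)+\frac1\beta\omega(v)^2>0$ for every nonzero $v\in TS$; it is time-oriented by the timelike Killing field $\partial_t$. Its Fermat metric is $F(v)=\frac1\beta\omega(v)+\sqrt{\frac1{\beta^2}\omega(v)^2+\frac1\beta g_0(v,v)}$. The pre-distance $d_F(x_0,x_1)\in\mathbb{R}\cup\{-\infty\}$ is the infimum of $\ell_F(c)=\int F(\dot c)\,ds$ over piecewise smooth curves $c$ from $x_0$ to $x_1$ (constant curves allowed), and $d_s(x,y)=\frac12(d_F(x,y)+d_F(y,x))$. $p\ll q$ means there is a future-directed timelike curve from $p$ to $q$. $(M,g)$ is totally vicious if $p\ll p$ for all $p\in M$, and chronological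 if $p\not\ll p$ for all $p\in M$. *)

theory Defs
  imports "HOL-Analysis.Analysis"
begin

section \<open>Smooth manifolds\<close>

text \<open>Only used for open sets \<open>S\<close> of Euclidean spaces, where the existence and continuity of all
  iterated directional derivatives up to order \<open>n\<close> is the usual notion of class \<open>C\<^sup>n\<close>.\<close>

primrec Ck_on :: "nat \<Rightarrow> 'b::real_normed_vector set \<Rightarrow> ('b \<Rightarrow> 'c::real_normed_vector) \<Rightarrow> bool" where
  "Ck_on 0 = (\<lambda>S f. continuous_on S f)"
| "Ck_on (Suc n) = (\<lambda>S f. (\<forall>x\<in>S. f differentiable (at x)) \<and>
     (\<forall>v. Ck_on n S (\<lambda>x. frechet_derivative f (at x) v)))"

definition smooth_on :: "'b::real_normed_vector set \<Rightarrow> ('b \<Rightarrow> 'c::real_normed_vector) \<Rightarrow> bool" where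
  "smooth_on S f \<longleftrightarrow> (\<forall>n. Ck_on n S f)"

text \<open>A chart is its domain together with a coordinate map; the values of the coordinate map
  outside the domain are irrelevant.\<close>

type_synonym ('a, 'e) chart = "'a set \<times> ('a \<Rightarrow> 'e)"

abbreviation chart_inv :: "('a, 'e) chart \<Rightarrow> 'e \<Rightarrow> 'a" where
  "chart_inv \<phi> \<equiv> inv_into (fst \<phi>) (snd \<phi>)"

definition is_chart :: "('a::topological_space, 'e::euclidean_space) chart \<Rightarrow> bool" where
  "is_chart \<phi> \<longleftrightarrow> open (fst \<phi>) \<and> open (snd \<phi> ` fst \<phi>) \<and>
     homeomorphism (fst \<phi>) (snd \<phi> ` fst \<phi>) (snd \<phi>) (chart_inv \<phi>)"

definition smooth_atlas :: "('a::topological_space, 'e::euclidean_space) chart set \<Rightarrow> bool" where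
  "smooth_atlas A \<longleftrightarrow> (\<forall>\<phi>\<in>A. is_chart \<phi>) \<and> (\<Union>\<phi>\<in>A. fst \<phi>) = UNIV \<and>
     (\<forall>\<phi>\<in>A. \<forall>\<psi>\<in>A. smooth_on (snd \<phi> ` (fst \<phi> \<inter> fst \<psi>)) (snd \<psi> \<circ> chart_inv \<phi>))"

definition charts_at :: "('a, 'e) chart set \<Rightarrow> 'a \<Rightarrow> ('a, 'e) chart set" where
  "charts_at A x = {\<phi> \<in> A. x \<in> fst \<phi>}"

text \<open>A tangent vector at \<open>x\<close> is a family of coordinate vectors, one for each chart of the atlas
  around \<open>x\<close>, which transform into each other under the differentials of the coordinate changes.
  The family is put to \<open>0\<close> on all other arguments, so that equality of tangent vectors is equality
  of functions.\<close>

type_synonym ('a, 'e) tvec = "('a, 'e) chart \<Rightarrow> 'e"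

definition tangent_space ::
    "('a, 'e::euclidean_space) chart set \<Rightarrow> 'a \<Rightarrow> ('a, 'e) tvec set" where
  "tangent_space A x = {v. (\<forall>\<phi>. \<phi> \<notin> charts_at A x \<longrightarrow> v \<phi> = 0) \<and>
     (\<forall>\<phi>\<in>charts_at A x. \<forall>\<psi>\<in>charts_at A x.
        v \<psi> = frechet_derivative (snd \<psi> \<circ> chart_inv \<phi>) (at (snd \<phi> x)) (v \<phi>))}"

text \<open>The tangent vector at \<open>x\<close> whose coordinates in the chart \<open>\<phi>\<close> around \<open>x\<close> are \<open>u\<close>.\<close>

definition coord_vec ::
    "('a, 'e::euclidean_space) chart set \<Rightarrow> ('a, 'e) chart \<Rightarrow> 'a \<Rightarrow> 'e \<Rightarrow> ('a, 'e) tvec" where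
  "coord_vec A \<phi> x u = (\<lambda>\<psi>. if \<psi> \<in> charts_at A x
     then frechet_derivative (snd \<psi> \<circ> chart_inv \<phi>) (at (snd \<phi> x)) u else 0)"

text \<open>The differential at \<open>x\<close> of a smooth map \<open>f\<close> between manifolds with atlases \<open>A\<close> and \<open>B\<close>. On
  tangent vectors the result does not depend on the chosen chart.\<close>

definition tangent_map ::
    "('a, 'e::euclidean_space) chart set \<Rightarrow> ('b, 'f::euclidean_space) chart set \<Rightarrow> ('a \<Rightarrow> 'b) \<Rightarrow>
     'a \<Rightarrow> ('a, 'e) tvec \<Rightarrow> ('b, 'f) tvec" where
  "tangent_map A B f x v = (\<lambda>\<psi>. if \<psi> \<in> charts_at B (f x)
     then (let \<phi> = (SOME \<phi>. \<phi> \<in> charts_at A x) in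
             frechet_derivative (snd \<psi> \<circ> f \<circ> chart_inv \<phi>) (at (snd \<phi> x)) (v \<phi>))
     else 0)"

definition euclidean_atlas :: "('e::euclidean_space, 'e) chart set" where
  "euclidean_atlas = {(UNIV, id)}"

definition prod_atlas ::
    "('a, 'e) chart set \<Rightarrow> ('b, 'f) chart set \<Rightarrow> ('a \<times> 'b, 'e \<times> 'f) chart set" where
  "prod_atlas A B = (\<lambda>(\<phi>, \<psi>). (fst \<phi> \<times> fst \<psi>, map_prod (snd \<phi>) (snd \<psi>))) ` (A \<times> B)"

definition smooth_function :: "('a, 'e::euclidean_space) chart set \<Rightarrow> ('a \<Rightarrow> real) \<Rightarrow> bool" where
  "smooth_function A f \<longleftrightarrow> (\<forall>\<phi>\<in>A. smooth_on (snd \<phi> ` fst \<phi>) (f \<circ> chart_inv \<phi>))"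

definition linear_on_tangent ::
    "('a, 'e::euclidean_space) chart set \<Rightarrow> 'a \<Rightarrow> (('a, 'e) tvec \<Rightarrow> real) \<Rightarrow> bool" where
  "linear_on_tangent A x L \<longleftrightarrow> (\<forall>v\<in>tangent_space A x. \<forall>w\<in>tangent_space A x. \<forall>a b.
     L (\<lambda>\<phi>. a *\<^sub>R v \<phi> + b *\<^sub>R w \<phi>) = a * L v + b * L w)"

definition one_form ::
    "('a, 'e::euclidean_space) chart set \<Rightarrow> ('a \<Rightarrow> ('a, 'e) tvec \<Rightarrow> real) \<Rightarrow> bool" where
  "one_form A \<omega> \<longleftrightarrow> (\<forall>x. linear_on_tangent A x (\<omega> x)) \<and>
     (\<forall>\<phi>\<in>A. \<forall>u. smooth_on (snd \<phi> ` fst \<phi>)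
        (\<lambda>y. \<omega> (chart_inv \<phi> y) (coord_vec A \<phi> (chart_inv \<phi> y) u)))"

definition symmetric_tensor ::
    "('a, 'e::euclidean_space) chart set \<Rightarrow>
     ('a \<Rightarrow> ('a, 'e) tvec \<Rightarrow> ('a, 'e) tvec \<Rightarrow> real) \<Rightarrow> bool" where
  "symmetric_tensor A h \<longleftrightarrow>
     (\<forall>x. \<forall>v\<in>tangent_space A x. linear_on_tangent A x (h x v)) \<and>
     (\<forall>x. \<forall>v\<in>tangent_space A x. \<forall>w\<in>tangent_space A x. h x v w = h x w v) \<and>
     (\<forall>\<phi>\<in>A. \<forall>u w. smooth_on (snd \<phi> ` fst \<phi>)
        (\<lambda>y. h (chart_inv \<phi> y) (coord_vec A \<phi> (chart_inv \<phi> y) u)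
                               (coord_vec A \<phi> (chart_inv \<phi> y) w)))"


section \<open>Piecewise smooth curves\<close>

text \<open>For a curve on an interval \<open>T\<close>; at an endpoint of \<open>T\<close> this is the one-sided velocity.\<close>

definition velocity ::
    "('a, 'e::euclidean_space) chart set \<Rightarrow> (real \<Rightarrow> 'a) \<Rightarrow> real set \<Rightarrow> real \<Rightarrow> ('a, 'e) tvec" where
  "velocity A c T s = (\<lambda>\<phi>. if \<phi> \<in> charts_at A (c s)
     then vector_derivative (snd \<phi> \<circ> c) (at s within T) else 0)"

definition smooth_curve ::
    "('a::topological_space, 'e::euclidean_space) chart set \<Rightarrow> real set \<Rightarrow> (real \<Rightarrow> 'a) \<Rightarrow> bool" where
  "smooth_curve A T c \<longleftrightarrow> continuous_on T c \<and>
     (\<forall>\<phi>\<in>A. smooth_on {s\<in>T. c s \<in> fst \<phi>} (snd \<phi> \<circ> c))"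

text \<open>Smoothness on a compact interval means existence of a smooth extension to an open one.\<close>

definition smooth_segment ::
    "('a::topological_space, 'e::euclidean_space) chart set \<Rightarrow> real \<Rightarrow> real \<Rightarrow> (real \<Rightarrow> 'a) \<Rightarrow> bool" where
  "smooth_segment A p q c \<longleftrightarrow> p < q \<and>
     (\<exists>\<epsilon>>0. \<exists>c'. smooth_curve A {p-\<epsilon><..<q+\<epsilon>} c' \<and> (\<forall>s\<in>{p..q}. c' s = c s))"

definition subdivision :: "real \<Rightarrow> real \<Rightarrow> nat \<Rightarrow> (nat \<Rightarrow> real) \<Rightarrow> bool" where
  "subdivision a b n p \<longleftrightarrow> 0 < n \<and> p 0 = a \<and> p n = b \<and> (\<forall>i<n. p i < p (Suc i))"

text \<open>A smooth segment contains its endpoints, so consecutive pieces match and the curve is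
  continuous. The velocity is allowed to vanish; in particular constant curves are included.\<close>

definition piecewise_smooth_curve ::
    "('a::topological_space, 'e::euclidean_space) chart set \<Rightarrow> real \<Rightarrow> real \<Rightarrow> (real \<Rightarrow> 'a) \<Rightarrow> bool" where
  "piecewise_smooth_curve A a b c \<longleftrightarrow>
     (\<exists>n p. subdivision a b n p \<and> (\<forall>i<n. smooth_segment A (p i) (p (Suc i)) c))"


section \<open>Causality of time-oriented spacetimes\<close>

text \<open>In this section \<open>g\<close> is a Lorentzian metric of signature \<open>(-,+,\<dots>,+)\<close> and \<open>X\<close> a timelike
  vector field defining the time-orientation.\<close>

definition future_timelike ::
    "('b \<Rightarrow> ('b, 'f) tvec \<Rightarrow> ('b, 'f) tvec \<Rightarrow> real) \<Rightarrow> ('b \<Rightarrow> ('b, 'f) tvec) \<Rightarrow>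
     'b \<Rightarrow> ('b, 'f) tvec \<Rightarrow> bool" where
  "future_timelike g X p v \<longleftrightarrow> g p v v < 0 \<and> g p (X p) v < 0"

text \<open>At a break point both one-sided velocities have to be timelike and future-directed.\<close>

definition future_timelike_curve ::
    "('b::topological_space, 'f::euclidean_space) chart set \<Rightarrow>
     ('b \<Rightarrow> ('b, 'f) tvec \<Rightarrow> ('b, 'f) tvec \<Rightarrow> real) \<Rightarrow> ('b \<Rightarrow> ('b, 'f) tvec) \<Rightarrow>
     real \<Rightarrow> real \<Rightarrow> (real \<Rightarrow> 'b) \<Rightarrow> bool" where
  "future_timelike_curve A g X a b \<gamma> \<longleftrightarrow>
     (\<exists>n p. subdivision a b n p \<and>
       (\<forall>i<n. smooth_segment A (p i) (p (Suc i)) \<gamma> \<and>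
         (\<forall>s\<in>{p i..p (Suc i)}. future_timelike g X (\<gamma> s) (velocity A \<gamma> {p i..p (Suc i)} s))))"

definition chron_rel ::
    "('b::topological_space, 'f::euclidean_space) chart set \<Rightarrow>
     ('b \<Rightarrow> ('b, 'f) tvec \<Rightarrow> ('b, 'f) tvec \<Rightarrow> real) \<Rightarrow> ('b \<Rightarrow> ('b, 'f) tvec) \<Rightarrow>
     'b \<Rightarrow> 'b \<Rightarrow> bool" where
  "chron_rel A g X p q \<longleftrightarrow>
     (\<exists>a b \<gamma>. future_timelike_curve A g X a b \<gamma> \<and> \<gamma> a = p \<and> \<gamma> b = q)"

definition totally_vicious ::
    "('b::topological_space, 'f::euclidean_space) chart set \<Rightarrow>
     ('b \<Rightarrow> ('b, 'f) tvec \<Rightarrow> ('b, 'f) tvec \<Rightarrow> real) \<Rightarrow> ('b \<Rightarrow> ('b, 'f) tvec) \<Rightarrow> bool" where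
  "totally_vicious A g X \<longleftrightarrow> (\<forall>p. chron_rel A g X p p)"

definition chronological ::
    "('b::topological_space, 'f::euclidean_space) chart set \<Rightarrow>
     ('b \<Rightarrow> ('b, 'f) tvec \<Rightarrow> ('b, 'f) tvec \<Rightarrow> real) \<Rightarrow> ('b \<Rightarrow> ('b, 'f) tvec) \<Rightarrow> bool" where
  "chronological A g X \<longleftrightarrow> (\<forall>p. \<not> chron_rel A g X p p)"


section \<open>SOM-spacetimes and their Fermat metric\<close>

locale SOM_spacetime =
  fixes A :: "('a::{t2_space,second_countable_topology}, 'e::euclidean_space) chart set"
    and \<beta> :: "'a \<Rightarrow> real"
    and \<omega> :: "'a \<Rightarrow> ('a, 'e) tvec \<Rightarrow> real"
    and g\<^sub>0 :: "'a \<Rightarrow> ('a, 'e) tvec \<Rightarrow> ('a, 'e) tvec \<Rightarrow> real"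
  assumes connected: "connected (UNIV :: 'a set)"
    and atlas: "smooth_atlas A"
    and beta_smooth: "smooth_function A \<beta>"
    and beta_pos: "\<beta> x > 0"
    and omega: "one_form A \<omega>"
    and g0: "symmetric_tensor A g\<^sub>0"
    and pos: "\<lbrakk>v \<in> tangent_space A x; v \<noteq> (\<lambda>_. 0)\<rbrakk> \<Longrightarrow> g\<^sub>0 x v v + (1 / \<beta> x) * (\<omega> x v)\<^sup>2 > 0"

abbreviation SOM_atlas ::
    "('a, 'e::euclidean_space) chart set \<Rightarrow> (real \<times> 'a, real \<times> 'e) chart set" where
  "SOM_atlas A \<equiv> prod_atlas euclidean_atlas A"

definition dt ::
    "('a, 'e::euclidean_space) chart set \<Rightarrow> real \<times> 'a \<Rightarrow> (real \<times> 'a, real \<times> 'e) tvec \<Rightarrow> real" where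
  "dt A p V = tangent_map (SOM_atlas A) euclidean_atlas fst p V (UNIV, id)"

definition dproj ::
    "('a, 'e::euclidean_space) chart set \<Rightarrow> real \<times> 'a \<Rightarrow> (real \<times> 'a, real \<times> 'e) tvec \<Rightarrow>
     ('a, 'e) tvec" where
  "dproj A p V = tangent_map (SOM_atlas A) A snd p V"

text \<open>Here \<open>\<beta>\<close>, \<open>\<omega>\<close> and \<open>g\<^sub>0\<close> are pulled back to \<open>\<real> \<times> S\<close> along the projection to \<open>S\<close>.\<close>

definition SOM_metric ::
    "('a, 'e::euclidean_space) chart set \<Rightarrow> ('a \<Rightarrow> real) \<Rightarrow> ('a \<Rightarrow> ('a, 'e) tvec \<Rightarrow> real) \<Rightarrow>
     ('a \<Rightarrow> ('a, 'e) tvec \<Rightarrow> ('a, 'e) tvec \<Rightarrow> real) \<Rightarrow>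
     real \<times> 'a \<Rightarrow> (real \<times> 'a, real \<times> 'e) tvec \<Rightarrow> (real \<times> 'a, real \<times> 'e) tvec \<Rightarrow> real" where
  "SOM_metric A \<beta> \<omega> g\<^sub>0 p V W =
     - \<beta> (snd p) * dt A p V * dt A p W
     + dt A p V * \<omega> (snd p) (dproj A p W) + \<omega> (snd p) (dproj A p V) * dt A p W
     + g\<^sub>0 (snd p) (dproj A p V) (dproj A p W)"

text \<open>The coordinate vector field of the first factor: the velocity of \<open>t \<mapsto> (t, x)\<close>.\<close>

definition del_t ::
    "('a, 'e::euclidean_space) chart set \<Rightarrow> real \<times> 'a \<Rightarrow> (real \<times> 'a, real \<times> 'e) tvec" where
  "del_t A p = velocity (SOM_atlas A) (\<lambda>t. (t, snd p)) UNIV (fst p)"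

definition fermat ::
    "('a \<Rightarrow> real) \<Rightarrow> ('a \<Rightarrow> ('a, 'e) tvec \<Rightarrow> real) \<Rightarrow>
     ('a \<Rightarrow> ('a, 'e) tvec \<Rightarrow> ('a, 'e) tvec \<Rightarrow> real) \<Rightarrow> 'a \<Rightarrow> ('a, 'e) tvec \<Rightarrow> real" where
  "fermat \<beta> \<omega> g\<^sub>0 x v =
     (1 / \<beta> x) * \<omega> x v + sqrt ((1 / (\<beta> x)\<^sup>2) * (\<omega> x v)\<^sup>2 + (1 / \<beta> x) * g\<^sub>0 x v v)"

text \<open>At the finitely many break points of a piecewise smooth curve the integrand has an
  arbitrary value, which does not affect the integral.\<close>

definition fermat_length ::
    "('a, 'e::euclidean_space) chart set \<Rightarrow> ('a \<Rightarrow> real) \<Rightarrow> ('a \<Rightarrow> ('a, 'e) tvec \<Rightarrow> real) \<Rightarrow>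
     ('a \<Rightarrow> ('a, 'e) tvec \<Rightarrow> ('a, 'e) tvec \<Rightarrow> real) \<Rightarrow> real \<Rightarrow> real \<Rightarrow> (real \<Rightarrow> 'a) \<Rightarrow> real" where
  "fermat_length A \<beta> \<omega> g\<^sub>0 a b c =
     integral {a..b} (\<lambda>s. fermat \<beta> \<omega> g\<^sub>0 (c s) (velocity A c {a..b} s))"

definition fermat_dist ::
    "('a::topological_space, 'e::euclidean_space) chart set \<Rightarrow> ('a \<Rightarrow> real) \<Rightarrow>
     ('a \<Rightarrow> ('a, 'e) tvec \<Rightarrow> real) \<Rightarrow> ('a \<Rightarrow> ('a, 'e) tvec \<Rightarrow> ('a, 'e) tvec \<Rightarrow> real) \<Rightarrow>
     'a \<Rightarrow> 'a \<Rightarrow> ereal" where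
  "fermat_dist A \<beta> \<omega> g\<^sub>0 x y =
     Inf {ereal (fermat_length A \<beta> \<omega> g\<^sub>0 a b c) | a b c.
            piecewise_smooth_curve A a b c \<and> c a = x \<and> c b = y}"

text \<open>On a connected manifold \<open>fermat_dist\<close> never takes the value \<open>\<infinity>\<close>, so the convention
  \<open>\<infinity> + (-\<infinity>) = \<infinity>\<close> for \<^typ>\<open>ereal\<close> plays no role here.\<close>

definition fermat_sym_dist ::
    "('a::topological_space, 'e::euclidean_space) chart set \<Rightarrow> ('a \<Rightarrow> real) \<Rightarrow>
     ('a \<Rightarrow> ('a, 'e) tvec \<Rightarrow> real) \<Rightarrow> ('a \<Rightarrow> ('a, 'e) tvec \<Rightarrow> ('a, 'e) tvec \<Rightarrow> real) \<Rightarrow>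
     'a \<Rightarrow> 'a \<Rightarrow> ereal" where
  "fermat_sym_dist A \<beta> \<omega> g\<^sub>0 x y =
     (1 / 2) * (fermat_dist A \<beta> \<omega> g\<^sub>0 x y + fermat_dist A \<beta> \<omega> g\<^sub>0 y x)"

end

theory Submission
  imports Defs
begin

text \<open>
  The idea is that the Fermat metric measures arrival times of light. Completing the square in the
  metric shows that a tangent vector \<open>(\<tau>, v)\<close> of \<open>\<real> \<times> S\<close> is timelike and future-directed iff \<open>F v < \<tau>\<close>
  (lemma \<open>future_timelike_iff\<close>). Integrating along curves, \<open>(t, x)\<close> lies in the chronological past
  of \<open>(t', y)\<close> iff some piecewise smooth curve from \<open>x\<close> to \<open>y\<close> has Fermat length below \<open>t' - t\<close>
  (lemma \<open>chron_iff\<close>). One direction is the monotonicity of the integral. For the other one a curve in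
  \<open>S\<close> must be given a smooth time component whose rate exceeds \<open>F\<close>; as \<open>F\<close> is merely continuous along
  the curve, the rate is chosen as a polynomial, by the Weierstrass theorem.

  In particular a point over \<open>x\<close> lies on a closed timelike curve iff there is a loop at \<open>x\<close> of negative
  Fermat length, that is, iff \<open>d\<^sub>F(x, x) < 0\<close>. A single loop of negative length can be
  reached from every point, because \<open>S\<close> is connected by piecewise smooth curves
  (lemma \<open>linked_exists\<close>), and repeating it makes connecting curves arbitrarily short: then
  \<open>d\<^sub>F\<close> is \<open>-\<infinity>\<close> everywhere and all points lie on closed timelike curves
  (lemma \<open>negative_loop_imp_dist_minf\<close>). So there are only two cases: either \<open>d\<^sub>F \<equiv> -\<infinity>\<close> and the
  spacetime is totally vicious, or \<open>d\<^sub>F(x, x) = 0\<close> for all \<open>x\<close>, constant curves having length zero, and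
  the spacetime is chronological. The criterion with the symmetrized pre-distance follows because a
  curve from \<open>x\<close> to \<open>y\<close> followed by one from \<open>y\<close> to \<open>x\<close> is a loop.
\<close>

section \<open>Calculus\<close>

lemma Ck_on_SucD:
  assumes "Ck_on (Suc n) S f"
  shows "x \<in> S \<Longrightarrow> (f has_derivative frechet_derivative f (at x)) (at x)"
    and "Ck_on n S (\<lambda>x. frechet_derivative f (at x) v)"
proof -
  have 1: "\<forall>x\<in>S. f differentiable (at x)" "\<forall>v. Ck_on n S (\<lambda>x. frechet_derivative f (at x) v)"
    using assms unfolding Ck_on.simps by blast+
  show "(f has_derivative frechet_derivative f (at x)) (at x)" if "x \<in> S"
    using 1(1) that frechet_derivative_works by blast
  show "Ck_on n S (\<lambda>x. frechet_derivative f (at x) v)" using 1(2) by blast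
qed

lemma Ck_on_cong:
  assumes "open S" and "\<And>x. x \<in> S \<Longrightarrow> f x = g x" and "Ck_on n S f"
  shows "Ck_on n S g"
  using assms(2,3)
proof (induction n arbitrary: f g)
  case 0
  then have "continuous_on S f = continuous_on S g"
    by (intro continuous_on_cong) simp_all
  then show ?case using 0 by simp
next
  case (Suc n)
  have deriv: "(g has_derivative frechet_derivative f (at x)) (at x)" if "x \<in> S" for x
    by (rule has_derivative_transform_within_open[OF Ck_on_SucD(1)[OF Suc.prems(2) that] \<open>open S\<close> that Suc.prems(1)])
  have eq: "frechet_derivative f (at x) = frechet_derivative g (at x)" if "x \<in> S" for x
    using frechet_derivative_at[OF deriv[OF that]] .
  have "Ck_on n S (\<lambda>x. frechet_derivative g (at x) v)" for v
    by (rule Suc.IH[OF _ Ck_on_SucD(2)[OF Suc.prems(2), of v]]) (simp add: eq)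
  then show ?case using deriv unfolding Ck_on.simps differentiable_def by blast
qed

text \<open>Lets the derivative be given by any formula \<open>f'\<close> valid on \<open>S\<close>; without it every induction on
  the order of differentiability would have to compute \<open>frechet_derivative\<close> itself.\<close>
lemma Ck_on_SucI:
  assumes "open S" and "\<And>x. x \<in> S \<Longrightarrow> (f has_derivative f' x) (at x)"
    and "\<And>v. Ck_on n S (\<lambda>x. f' x v)"
  shows "Ck_on (Suc n) S f"
proof -
  have "Ck_on n S (\<lambda>x. frechet_derivative f (at x) v)" for v
    using assms(1) _ assms(3)[of v]
  proof (rule Ck_on_cong)
    show "f' x v = frechet_derivative f (at x) v" if "x \<in> S" for x
      using frechet_derivative_at[OF assms(2)[OF that]] by simp
  qed
  then show ?thesis using assms(2) unfolding Ck_on.simps differentiable_def by blast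
qed

lemma Ck_on_subset:
  assumes "Ck_on n S f" and "T \<subseteq> S"
  shows "Ck_on n T f"
  using assms(1)
proof (induction n arbitrary: f)
  case 0
  then show ?case using continuous_on_subset[OF _ assms(2)] by simp
next
  case (Suc n)
  then show ?case using assms(2) unfolding Ck_on.simps by blast
qed

lemma Ck_on_bounded_linear:
  assumes "open S" and "bounded_linear h" and "Ck_on n S f"
  shows "Ck_on n S (\<lambda>x. h (f x))"
  using assms(3)
proof (induction n arbitrary: f)
  case 0
  then show ?case
    using bounded_linear.continuous_on[OF assms(2)] by auto
next
  case (Suc n)
  show ?case
  proof (rule Ck_on_SucI[OF \<open>open S\<close>])
    show "((\<lambda>x. h (f x)) has_derivative (\<lambda>v. h (frechet_derivative f (at x) v))) (at x)"
      if "x \<in> S" for x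
      by (rule bounded_linear.has_derivative[OF assms(2) Ck_on_SucD(1)[OF Suc.prems that]])
  qed (rule Suc.IH[OF Ck_on_SucD(2)[OF Suc.prems]])
qed

lemma Ck_on_Pair:
  assumes "open S" and "Ck_on n S f" and "Ck_on n S g"
  shows "Ck_on n S (\<lambda>x. (f x, g x))"
  using assms(2,3)
proof (induction n arbitrary: f g)
  case 0
  then show ?case by (auto intro: continuous_on_Pair)
next
  case (Suc n)
  show ?case
    by (rule Ck_on_SucI[OF \<open>open S\<close> has_derivative_Pair])
      (auto intro: Ck_on_SucD(1)[OF Suc.prems(1)] Ck_on_SucD(1)[OF Suc.prems(2)]
        Suc.IH Ck_on_SucD(2)[OF Suc.prems(1)] Ck_on_SucD(2)[OF Suc.prems(2)])
qed

text \<open>Composition with general smooth maps needs product rules of all orders. For an affine inner map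
  the derivative in direction \<open>v\<close> is the derivative of \<open>f\<close> in the fixed direction \<open>l v\<close>, so the
  induction closes at once. This covers both translations of the parameter and straight lines in
  a chart, the only curves in \<open>S\<close> that have to be constructed.\<close>
lemma Ck_on_affine:
  assumes "open S" and "bounded_linear l" and "Ck_on n S f"
  shows "Ck_on n {s. a + l s \<in> S} (\<lambda>s. f (a + l s))"
proof -
  have L: "((\<lambda>s. a + l s) has_derivative l) (at s within T)" for s T
    by (auto intro!: derivative_eq_intros bounded_linear.has_derivative[OF assms(2)])
  have cont: "continuous_on T (\<lambda>s. a + l s)" for T
    by (intro continuous_intros linear_continuous_on assms(2))
  have op: "open {s. a + l s \<in> S}"
    using open_vimage[OF \<open>open S\<close> cont] by (simp add: vimage_def)
  show ?thesis
    using assms(3)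
  proof (induction n arbitrary: f)
    case 0
    then show ?case
      using continuous_on_compose2[OF _ cont, of S f "{s. a + l s \<in> S}"]
      by (simp add: image_subset_iff)
  next
    case (Suc n)
    show ?case
    proof (rule Ck_on_SucI[OF op])
      show "((\<lambda>s. f (a + l s)) has_derivative (\<lambda>v. frechet_derivative f (at (a + l s)) (l v))) (at s)"
        if "s \<in> {s. a + l s \<in> S}" for s
        using has_derivative_compose[OF L Ck_on_SucD(1)[OF Suc.prems]] that by auto
    qed (rule Suc.IH[OF Ck_on_SucD(2)[OF Suc.prems]])
  qed
qed

lemma Ck_on_real_polynomial:
  fixes p :: "real \<Rightarrow> real"
  assumes "open S" and "real_polynomial_function p"
  shows "Ck_on n S p"
  using assms(2)
proof (induction n arbitrary: p)
  case 0
  then show ?case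
    using continuous_on_polymonial_function real_polynomial_function_eq
    by (metis Ck_on.simps(1))
next
  case (Suc n)
  obtain p' where p': "real_polynomial_function p'" "\<And>x. (p has_real_derivative p' x) (at x)"
    using has_real_derivative_polynomial_function[OF Suc.prems] by blast
  show ?case
  proof (rule Ck_on_SucI[OF \<open>open S\<close>])
    show "(p has_derivative (\<lambda>v. p' x * v)) (at x)" for x
      using p'(2)[of x] by (simp add: has_field_derivative_def)
    show "Ck_on n S (\<lambda>x. p' x * v)" for v
      by (rule Suc.IH) (auto intro: p' real_polynomial_function.intros)
  qed
qed

lemma real_polynomial_primitive:
  assumes "real_polynomial_function p"
  obtains P where "real_polynomial_function P" "\<And>x. (P has_real_derivative p x) (at x)"
proof -
  obtain a n where p: "p = (\<lambda>x. \<Sum>i\<le>n. a i * x^i)"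
    using assms by (auto simp: real_polynomial_function_iff_sum)
  let ?P = "\<lambda>x::real. \<Sum>i\<le>n. a i / (Suc i) * x^(Suc i)"
  have "(?P has_real_derivative p x) (at x)" for x
    unfolding p by (auto intro!: derivative_eq_intros sum.cong simp del: power_Suc)
  moreover have "real_polynomial_function ?P"
    by (intro real_polynomial_function_sum real_polynomial_function_power
        real_polynomial_function.intros) (auto intro: bounded_linear_ident)
  ultimately show thesis using that by blast
qed

text \<open>Here the time component of a timelike curve is found. The integrand \<open>f\<close> will be the Fermat
  speed of a smooth segment, which is continuous but not smooth where the velocity vanishes, so that
  \<open>t' = f + const\<close> is not an admissible choice. By Weierstrass, \<open>f + d\<close> has a polynomial
  approximation with error below \<open>d / 3\<close>; its integral misses \<open>T\<close> by at most \<open>d / 3\<close> per unit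
  of parameter, and the constant \<open>e\<close> correcting this still leaves the rate above \<open>f\<close>.\<close>
lemma polynomial_rate_above:
  fixes f :: "real \<Rightarrow> real"
  assumes "p < q" and f: "continuous_on {p..q} f" and T: "integral {p..q} f < T"
  obtains H h where "real_polynomial_function H" "\<And>x. (H has_real_derivative h x) (at x)"
    "\<And>x. x \<in> {p..q} \<Longrightarrow> f x < h x" "H p = t" "H q = t + T"
proof -
  \<comment> \<open>the slack per unit of parameter\<close>
  define d where "d = (T - integral {p..q} f) / (q - p)"
  have d: "d > 0" using assms by (auto simp: d_def)
  obtain g where g: "real_polynomial_function g" "\<And>x. x \<in> {p..q} \<Longrightarrow> \<bar>f x + d - g x\<bar> < d / 3"
  proof (rule Stone_Weierstrass_real_polynomial_function)
    show "continuous_on {p..q} (\<lambda>x. f x + d)" by (intro continuous_intros f)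
    show "0 < d / 3" using d by simp
  qed auto
  obtain G where G: "real_polynomial_function G" "\<And>x. (G has_real_derivative g x) (at x)"
    using real_polynomial_primitive[OF g(1)] by metis
  have G': "integral {p..q} g = G q - G p"
    using G \<open>p < q\<close>
    by (intro integral_unique fundamental_theorem_of_calculus)
      (auto simp: has_real_derivative_iff_has_vector_derivative[symmetric] intro: DERIV_subset)
  have gc: "continuous_on {p..q} g"
    using continuous_on_polymonial_function[of g] g(1) by (simp add: real_polynomial_function_eq)
  have fi: "f integrable_on {p..q}" "g integrable_on {p..q}"
    using integrable_continuous_real f gc by blast+
  have T_eq: "T = integral {p..q} (\<lambda>x. f x + d)"
    using \<open>p < q\<close> integral_add[OF fi(1) integrable_const_ivl[of d]] by (simp add: d_def)
  have "norm (integral {p..q} (\<lambda>x. (f x + d) - g x)) \<le> d / 3 * (q - p)"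
    using g(2) \<open>p < q\<close> f gc
    by (intro integral_bound) (auto intro!: continuous_intros less_imp_le)
  then have close: "\<bar>T - (G q - G p)\<bar> \<le> d / 3 * (q - p)"
    using integral_diff[OF integrable_add[OF fi(1) integrable_const_ivl[of d]] fi(2)]
    by (simp add: T_eq G')
  \<comment> \<open>the correction of the rate that makes the increment exactly \<open>T\<close>\<close>
  define e where "e = (T - (G q - G p)) / (q - p)"
  have e: "\<bar>e\<bar> \<le> d / 3"
    using close \<open>p < q\<close> by (simp add: e_def abs_divide field_simps)
  show thesis
  proof (rule that[of "\<lambda>x. G x - G p + e * (x - p) + t" "\<lambda>x. g x + e"])
    show "real_polynomial_function (\<lambda>x. G x - G p + e * (x - p) + t)"
      by (intro real_polynomial_function.intros real_polynomial_function_diff G)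
        (auto intro: bounded_linear_ident)
    show "((\<lambda>x. G x - G p + e * (x - p) + t) has_real_derivative g x + e) (at x)" for x
      by (auto intro!: derivative_eq_intros G)
    show "f x < g x + e" if "x \<in> {p..q}" for x
      using g(2)[OF that] e d by (auto simp: abs_if split: if_splits)
    show "G q - G p + e * (q - p) + t = t + T"
      using \<open>p < q\<close> by (simp add: e_def)
  qed simp
qed

text \<open>A strict inequality between integrals, obtained from the monotonicity of
  \<open>t - \<integral>f\<close>: its derivative is positive everywhere, so the mean value theorem gives strictness
  without integrating \<open>t'\<close>.\<close>
lemma integral_less_increment:
  fixes f t :: "real \<Rightarrow> real"
  assumes "p < q" and f: "continuous_on {p..q} f"
    and t: "\<And>x. x \<in> {p..q} \<Longrightarrow> (t has_vector_derivative t' x) (at x within {p..q})"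
    and less: "\<And>x. x \<in> {p..q} \<Longrightarrow> f x < t' x"
  shows "integral {p..q} f < t q - t p"
proof -
  define G where "G x = t x - integral {p..x} f" for x
  have G: "(G has_vector_derivative t' x - f x) (at x within {p..q})" if "x \<in> {p..q}" for x
    unfolding G_def using that
    by (intro has_vector_derivative_diff t integral_has_vector_derivative f)
  have "G p < G q"
  proof (rule DERIV_pos_imp_increasing_open[OF \<open>p < q\<close>])
    show "\<exists>y. (G has_real_derivative y) (at x) \<and> 0 < y" if "p < x" "x < q" for x
      using G[of x] less[of x] that
      by (auto simp: at_within_Icc_at has_real_derivative_iff_has_vector_derivative
          intro!: exI[of _ "t' x - f x"])
    show "continuous_on {p..q} G"
      using G by (intro continuous_on_vector_derivative)
  qed
  then show ?thesis by (simp add: G_def)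
qed

section \<open>Charts, tangent vectors and velocities\<close>

lemma is_chartD:
  assumes "is_chart \<phi>"
  shows "open (fst \<phi>)" and "open (snd \<phi> ` fst \<phi>)" and "inj_on (snd \<phi>) (fst \<phi>)"
    and "continuous_on (fst \<phi>) (snd \<phi>)" and "continuous_on (snd \<phi> ` fst \<phi>) (chart_inv \<phi>)"
    and "x \<in> fst \<phi> \<Longrightarrow> chart_inv \<phi> (snd \<phi> x) = x"
proof -
  have h: "homeomorphism (fst \<phi>) (snd \<phi> ` fst \<phi>) (snd \<phi>) (chart_inv \<phi>)"
    using assms by (simp add: is_chart_def)
  show "open (fst \<phi>)" "open (snd \<phi> ` fst \<phi>)" using assms by (simp_all add: is_chart_def)
  show "continuous_on (fst \<phi>) (snd \<phi>)" "continuous_on (snd \<phi> ` fst \<phi>) (chart_inv \<phi>)"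
    using h by (simp_all add: homeomorphism_def)
  show "x \<in> fst \<phi> \<Longrightarrow> chart_inv \<phi> (snd \<phi> x) = x" using homeomorphism_apply1[OF h] by blast
  show "inj_on (snd \<phi>) (fst \<phi>)"
    by (rule inj_on_inverseI[of _ "chart_inv \<phi>"]) (rule homeomorphism_apply1[OF h])
qed

lemma open_chart_image:
  assumes "is_chart \<phi>" and "open U"
  shows "open (snd \<phi> ` (fst \<phi> \<inter> U))"
proof -
  have "snd \<phi> ` (fst \<phi> \<inter> U) = snd \<phi> ` fst \<phi> \<inter> chart_inv \<phi> -` U"
    using is_chartD(6)[OF assms(1)] by auto
  then show ?thesis
    using continuous_open_preimage[OF is_chartD(5,2)[OF assms(1)] assms(2)] by simp
qed

lemma charts_atD:
  assumes "smooth_atlas A" and "\<phi> \<in> charts_at A x"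
  shows "\<phi> \<in> A" and "is_chart \<phi>" and "x \<in> fst \<phi>"
  using assms by (auto simp: smooth_atlas_def charts_at_def)

lemma charts_at_nonempty:
  assumes "smooth_atlas A"
  obtains \<phi> where "\<phi> \<in> charts_at A x"
proof -
  have "x \<in> (\<Union>\<phi>\<in>A. fst \<phi>)" using assms by (simp add: smooth_atlas_def)
  then show thesis using that by (auto simp: charts_at_def)
qed

lemma transition_has_derivative:
  assumes "smooth_atlas A" and "\<phi> \<in> charts_at A x" and "\<psi> \<in> charts_at A x"
  shows "((snd \<psi> \<circ> chart_inv \<phi>) has_derivative
      frechet_derivative (snd \<psi> \<circ> chart_inv \<phi>) (at (snd \<phi> x))) (at (snd \<phi> x))"
proof (rule Ck_on_SucD(1))
  have "smooth_on (snd \<phi> ` (fst \<phi> \<inter> fst \<psi>)) (snd \<psi> \<circ> chart_inv \<phi>)"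
    using assms(1) charts_atD(1)[OF assms(1,2)] charts_atD(1)[OF assms(1,3)]
    unfolding smooth_atlas_def by blast
  then show "Ck_on (Suc 0) (snd \<phi> ` (fst \<phi> \<inter> fst \<psi>)) (snd \<psi> \<circ> chart_inv \<phi>)"
    by (simp only: smooth_on_def)
  show "snd \<phi> x \<in> snd \<phi> ` (fst \<phi> \<inter> fst \<psi>)"
    using charts_atD(3)[OF assms(1)] assms(2,3) by blast
qed

text \<open>The chain rule behind every change of coordinates below: with \<open>h\<close> another chart it relates the
  two coordinate velocities of \<open>c\<close>, and with \<open>h\<close> a map followed by a chart it gives the
  velocity of an image curve. The curve stays in \<open>U\<close> only near \<open>s\<close>, which is all that a derivative
  at \<open>s\<close> sees.\<close>
lemma has_vector_derivative_through_chart: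
  assumes U: "open U" "inj_on k U" "c s \<in> U"
    and c: "s \<in> T" "continuous (at s within T) c" "((k \<circ> c) has_vector_derivative u) (at s within T)"
    and h: "((h \<circ> inv_into U k) has_derivative G) (at (k (c s)))"
  shows "((h \<circ> c) has_vector_derivative G u) (at s within T)"
proof -
  have 1: "((h \<circ> inv_into U k \<circ> (k \<circ> c)) has_vector_derivative G u) (at s within T)"
    using vector_derivative_diff_chain_within[OF c(3), of "h \<circ> inv_into U k" G]
      has_derivative_at_withinI[OF h] by (simp add: o_def)
  have "\<forall>\<^sub>F s' in at s within T. c s' \<in> U"
    using c(2) U by (intro topological_tendstoD) (simp_all add: continuous_within)
  then have 2: "\<forall>\<^sub>F s' in at s within T. (h \<circ> inv_into U k \<circ> (k \<circ> c)) s' = (h \<circ> c) s'"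
    by eventually_elim (simp add: inv_into_f_f[OF U(2)])
  show ?thesis
    using 1 unfolding has_vector_derivative_def
    by (rule has_derivative_transform_eventually[OF _ 2])
      (simp_all add: inv_into_f_f[OF U(2,3)] c(1))
qed

text \<open>The compatibility demanded of a tangent vector is the cocycle rule for the differentials of the
  coordinate changes, that is, the chain rule for
  \<open>\<theta> \<circ> \<phi>\<inverse> = (\<theta> \<circ> \<psi>\<inverse>) \<circ> (\<psi> \<circ> \<phi>\<inverse>)\<close> near the point.\<close>
lemma coord_vec_in_tangent_space:
  assumes A: "smooth_atlas A" and \<phi>: "\<phi> \<in> charts_at A x"
  shows "coord_vec A \<phi> x u \<in> tangent_space A x"
proof -
  have cocycle: "frechet_derivative (snd \<theta> \<circ> chart_inv \<phi>) (at (snd \<phi> x)) u =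
      frechet_derivative (snd \<theta> \<circ> chart_inv \<psi>) (at (snd \<psi> x))
        (frechet_derivative (snd \<psi> \<circ> chart_inv \<phi>) (at (snd \<phi> x)) u)"
    if \<psi>: "\<psi> \<in> charts_at A x" and \<theta>: "\<theta> \<in> charts_at A x" for \<psi> \<theta>
  proof -
    note t = transition_has_derivative[OF A]
    have inv: "chart_inv \<phi> (snd \<phi> x) = x" if "x \<in> fst \<phi>" "\<phi> \<in> charts_at A y" for \<phi> x y
      using is_chartD(6)[OF charts_atD(2)[OF A that(2)] that(1)] .
    have "((snd \<theta> \<circ> chart_inv \<psi>) has_derivative
        frechet_derivative (snd \<theta> \<circ> chart_inv \<psi>) (at (snd \<psi> x)))
          (at ((snd \<psi> \<circ> chart_inv \<phi>) (snd \<phi> x)))"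
      using t[OF \<psi> \<theta>] by (simp add: inv[OF charts_atD(3)[OF A \<phi>] \<phi>])
    note comp = diff_chain_at[OF t[OF \<phi> \<psi>] this]
    have "((snd \<theta> \<circ> chart_inv \<phi>) has_derivative
        frechet_derivative (snd \<theta> \<circ> chart_inv \<psi>) (at (snd \<psi> x)) \<circ>
        frechet_derivative (snd \<psi> \<circ> chart_inv \<phi>) (at (snd \<phi> x))) (at (snd \<phi> x))"
    proof (rule has_derivative_transform_within_open[OF comp])
      show "open (snd \<phi> ` (fst \<phi> \<inter> fst \<psi>))"
        by (rule open_chart_image[OF charts_atD(2)[OF A \<phi>] is_chartD(1)[OF charts_atD(2)[OF A \<psi>]]])
      show "snd \<phi> x \<in> snd \<phi> ` (fst \<phi> \<inter> fst \<psi>)"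
        using charts_atD(3)[OF A] \<phi> \<psi> by blast
      show "((snd \<theta> \<circ> chart_inv \<psi>) \<circ> (snd \<psi> \<circ> chart_inv \<phi>)) y = (snd \<theta> \<circ> chart_inv \<phi>) y"
        if "y \<in> snd \<phi> ` (fst \<phi> \<inter> fst \<psi>)" for y
        using that by (auto simp: inv[OF _ \<phi>] inv[OF _ \<psi>])
    qed
    from frechet_derivative_at[OF this] show ?thesis by (metis comp_apply)
  qed
  show ?thesis
    unfolding tangent_space_def
  proof (intro CollectI conjI allI ballI impI)
    show "coord_vec A \<phi> x u \<theta> = frechet_derivative (snd \<theta> \<circ> chart_inv \<psi>) (at (snd \<psi> x))
        (coord_vec A \<phi> x u \<psi>)" if "\<psi> \<in> charts_at A x" "\<theta> \<in> charts_at A x" for \<psi> \<theta>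
      using cocycle[OF that] by (simp only: coord_vec_def that if_True)
  qed (simp add: coord_vec_def)
qed

lemma coord_vec_linear:
  assumes A: "smooth_atlas A" and \<phi>: "\<phi> \<in> charts_at A x"
  shows "coord_vec A \<phi> x (a *\<^sub>R u + b *\<^sub>R w) =
    (\<lambda>\<psi>. a *\<^sub>R coord_vec A \<phi> x u \<psi> + b *\<^sub>R coord_vec A \<phi> x w \<psi>)"
proof
  fix \<psi>
  show "coord_vec A \<phi> x (a *\<^sub>R u + b *\<^sub>R w) \<psi> =
      a *\<^sub>R coord_vec A \<phi> x u \<psi> + b *\<^sub>R coord_vec A \<phi> x w \<psi>"
  proof (cases "\<psi> \<in> charts_at A x")
    case True
    interpret bounded_linear "frechet_derivative (snd \<psi> \<circ> chart_inv \<phi>) (at (snd \<phi> x))"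
      using has_derivative_bounded_linear[OF transition_has_derivative[OF A \<phi> True]] .
    show ?thesis using True by (simp add: coord_vec_def add scaleR)
  qed (simp add: coord_vec_def)
qed

text \<open>Since \<open>coord_vec\<close> is linear in the coordinates, a one-form is determined by the coefficient
  functions whose smoothness is part of the definition of smooth one-forms and tensors.\<close>
lemma linear_on_tangent_coordinates:
  assumes A: "smooth_atlas A" and \<phi>: "\<phi> \<in> charts_at A x" and L: "linear_on_tangent A x L"
  shows "L (coord_vec A \<phi> x u) = (\<Sum>b\<in>Basis. (u \<bullet> b) * L (coord_vec A \<phi> x b))"
proof -
  have lin: "L (coord_vec A \<phi> x (a *\<^sub>R u + b *\<^sub>R w)) =
      a * L (coord_vec A \<phi> x u) + b * L (coord_vec A \<phi> x w)" for a b u w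
    using L coord_vec_in_tangent_space[OF A \<phi>]
    unfolding linear_on_tangent_def coord_vec_linear[OF A \<phi>] by blast
  have "linear (\<lambda>u. L (coord_vec A \<phi> x u))"
  proof (rule linearI)
    show "L (coord_vec A \<phi> x (u + w)) = L (coord_vec A \<phi> x u) + L (coord_vec A \<phi> x w)" for u w
      using lin[of 1 u 1 w] by simp
    show "L (coord_vec A \<phi> x (r *\<^sub>R u)) = r *\<^sub>R L (coord_vec A \<phi> x u)" for r u
      using lin[of r u 0 u] by simp
  qed
  then interpret linear "\<lambda>u. L (coord_vec A \<phi> x u)" .
  have "L (coord_vec A \<phi> x u) = L (coord_vec A \<phi> x (\<Sum>b\<in>Basis. (u \<bullet> b) *\<^sub>R b))"
    by (simp add: euclidean_representation)
  also have "\<dots> = (\<Sum>b\<in>Basis. L (coord_vec A \<phi> x ((u \<bullet> b) *\<^sub>R b)))" by (rule sum)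
  also have "\<dots> = (\<Sum>b\<in>Basis. (u \<bullet> b) * L (coord_vec A \<phi> x b))" by (simp add: scale)
  finally show ?thesis .
qed

lemma zero_in_tangent_space:
  assumes "smooth_atlas A"
  shows "(\<lambda>_. 0) \<in> tangent_space A x"
  using has_derivative_bounded_linear[OF transition_has_derivative[OF assms]]
  by (auto simp: tangent_space_def linear_simps)

lemma linear_on_tangent_zero:
  assumes "smooth_atlas A" and "linear_on_tangent A x L"
  shows "L (\<lambda>_. 0) = 0"
  using assms(2)[unfolded linear_on_tangent_def, rule_format, of "\<lambda>_. 0" "\<lambda>_. 0" 0 0]
    zero_in_tangent_space[OF assms(1), of x] by simp

lemma velocity_eq_coord_vec:
  assumes A: "smooth_atlas A" and \<phi>: "\<phi> \<in> charts_at A (c s)"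
    and c: "s \<in> T" "at s within T \<noteq> bot" "continuous (at s within T) c"
      "((snd \<phi> \<circ> c) has_vector_derivative u) (at s within T)"
  shows "velocity A c T s = coord_vec A \<phi> (c s) u"
proof
  fix \<psi>
  show "velocity A c T s \<psi> = coord_vec A \<phi> (c s) u \<psi>"
  proof (cases "\<psi> \<in> charts_at A (c s)")
    case True
    note ch = is_chartD[OF charts_atD(2)[OF A \<phi>]]
    have "((snd \<psi> \<circ> c) has_vector_derivative
        frechet_derivative (snd \<psi> \<circ> chart_inv \<phi>) (at (snd \<phi> (c s))) u) (at s within T)"
      by (rule has_vector_derivative_through_chart[OF ch(1,3) charts_atD(3)[OF A \<phi>] c(1,3,4)
            transition_has_derivative[OF A \<phi> True]])
    from vector_derivative_within[OF c(2) this] True show ?thesis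
      by (simp add: velocity_def coord_vec_def)
  qed (simp add: velocity_def coord_vec_def)
qed

text \<open>The differential of \<open>f\<close> sends the velocity of \<open>c\<close> to that of \<open>f \<circ> c\<close>; it is applied to the two
  projections of \<open>\<real> \<times> S\<close>. The chain rule is used in the chart that the definition of \<open>tangent_map\<close>
  happens to choose, so differentiability is assumed in all charts around the point.\<close>
lemma tangent_map_velocity:
  assumes ne: "charts_at A (c s) \<noteq> {}"
    and A: "\<And>\<phi>. \<phi> \<in> charts_at A (c s) \<Longrightarrow> open (fst \<phi>) \<and> inj_on (snd \<phi>) (fst \<phi>)"
    and c: "s \<in> T" "at s within T \<noteq> bot" "continuous (at s within T) c"
      "\<And>\<phi>. \<phi> \<in> charts_at A (c s) \<Longrightarrow> \<exists>u. ((snd \<phi> \<circ> c) has_vector_derivative u) (at s within T)"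
    and f: "\<And>\<phi> \<psi>. \<phi> \<in> charts_at A (c s) \<Longrightarrow> \<psi> \<in> charts_at B (f (c s)) \<Longrightarrow>
      (snd \<psi> \<circ> f \<circ> chart_inv \<phi>) differentiable (at (snd \<phi> (c s)))"
  shows "tangent_map A B f (c s) (velocity A c T s) = velocity B (f \<circ> c) T s"
proof
  fix \<psi>
  define \<phi> where "\<phi> = (SOME \<phi>. \<phi> \<in> charts_at A (c s))"
  have \<phi>: "\<phi> \<in> charts_at A (c s)" unfolding \<phi>_def using ne by (simp add: some_in_eq)
  then have in\<phi>: "c s \<in> fst \<phi>" by (simp add: charts_at_def)
  obtain u where u: "((snd \<phi> \<circ> c) has_vector_derivative u) (at s within T)" using c(4)[OF \<phi>] ..
  have V: "velocity A c T s \<phi> = u"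
    using vector_derivative_within[OF c(2) u] \<phi> by (simp add: velocity_def)
  show "tangent_map A B f (c s) (velocity A c T s) \<psi> = velocity B (f \<circ> c) T s \<psi>"
  proof (cases "\<psi> \<in> charts_at B (f (c s))")
    case True
    have "((snd \<psi> \<circ> f \<circ> chart_inv \<phi>) has_derivative
        frechet_derivative (snd \<psi> \<circ> f \<circ> chart_inv \<phi>) (at (snd \<phi> (c s)))) (at (snd \<phi> (c s)))"
      using f[OF \<phi> True] frechet_derivative_works by blast
    from has_vector_derivative_through_chart[OF conjunct1[OF A[OF \<phi>]] conjunct2[OF A[OF \<phi>]] in\<phi>
        c(1,3) u this]
    have "((snd \<psi> \<circ> f \<circ> c) has_vector_derivative
        frechet_derivative (snd \<psi> \<circ> f \<circ> chart_inv \<phi>) (at (snd \<phi> (c s))) u) (at s within T)" .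
    from vector_derivative_within[OF c(2) this]
    have "velocity B (f \<circ> c) T s \<psi> =
        frechet_derivative (snd \<psi> \<circ> f \<circ> chart_inv \<phi>) (at (snd \<phi> (c s))) u"
      using True by (simp add: velocity_def o_assoc)
    then show ?thesis
      using True by (simp add: tangent_map_def V Let_def flip: \<phi>_def)
  qed (simp add: tangent_map_def velocity_def)
qed

section \<open>Smooth segments\<close>

lemma smooth_segment_less: "smooth_segment A p q c \<Longrightarrow> p < q"
  by (simp add: smooth_segment_def)

lemma smooth_segment_continuous:
  assumes "smooth_segment A p q c"
  shows "continuous_on {p..q} c"
proof -
  obtain \<epsilon> c' where "\<epsilon> > 0" "smooth_curve A {p-\<epsilon><..<q+\<epsilon>} c'" "\<forall>s\<in>{p..q}. c' s = c s"
    using assms by (auto simp: smooth_segment_def)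
  then have "continuous_on {p..q} c'"
    by (auto simp: smooth_curve_def elim: continuous_on_subset)
  moreover have "continuous_on {p..q} c' = continuous_on {p..q} c"
    using \<open>\<forall>s\<in>{p..q}. c' s = c s\<close> by (intro continuous_on_cong) simp_all
  ultimately show ?thesis by simp
qed

lemma smooth_segment_cong:
  assumes "\<And>s. s \<in> {p..q} \<Longrightarrow> c s = d s"
  shows "smooth_segment A p q c \<longleftrightarrow> smooth_segment A p q d"
  using assms by (simp add: smooth_segment_def)

lemma at_within_Icc_neq_bot:
  fixes p q :: real
  assumes "p < q" and "s \<in> {p..q}"
  shows "at s within {p..q} \<noteq> bot"
  using assms by (simp add: trivial_limit_within islimpt_Icc)

text \<open>The derivative of the smooth extension of the segment provides \<open>u\<close>. It is continuous also at
  the endpoints, where it agrees with the one-sided derivative of \<open>c\<close>.\<close>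
lemma smooth_segment_chart_derivative:
  assumes c: "smooth_segment A p q c" and \<phi>: "\<phi> \<in> charts_at A (c s)" "open (fst \<phi>)"
    and s: "s \<in> {p..q}"
  obtains N u where "open N" "s \<in> N" "continuous_on N u"
    "\<And>r. r \<in> N \<inter> {p..q} \<Longrightarrow> \<phi> \<in> charts_at A (c r)"
    "\<And>r. r \<in> N \<inter> {p..q} \<Longrightarrow> ((snd \<phi> \<circ> c) has_vector_derivative u r) (at r within {p..q})"
proof -
  obtain \<epsilon> c' where \<epsilon>: "\<epsilon> > 0" and c': "smooth_curve A {p-\<epsilon><..<q+\<epsilon>} c'"
    and eq: "\<And>s. s \<in> {p..q} \<Longrightarrow> c s = c' s"
    using c by (auto simp: smooth_segment_def)
  define N where "N = {s\<in>{p-\<epsilon><..<q+\<epsilon>}. c' s \<in> fst \<phi>}"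
  have "\<phi> \<in> A" using \<phi> by (simp add: charts_at_def)
  then have sm: "Ck_on (Suc 0) N (snd \<phi> \<circ> c')"
    using c' unfolding smooth_curve_def N_def smooth_on_def by blast
  define u where "u r = frechet_derivative (snd \<phi> \<circ> c') (at r) 1" for r
  show thesis
  proof (rule that[of N u])
    have "{p-\<epsilon><..<q+\<epsilon>} \<inter> c' -` fst \<phi> = N" by (auto simp: N_def)
    moreover have "open ({p-\<epsilon><..<q+\<epsilon>} \<inter> c' -` fst \<phi>)"
      using c' \<phi>(2) by (intro continuous_open_preimage) (simp_all add: smooth_curve_def)
    ultimately show "open N" by simp
    show "s \<in> N" using s \<epsilon> \<phi>(1) eq[OF s] by (simp add: N_def charts_at_def)
    show "continuous_on N u" unfolding u_def using Ck_on_SucD(2)[OF sm, of 1] by simp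
    show "\<phi> \<in> charts_at A (c r)" if "r \<in> N \<inter> {p..q}" for r
      using that \<open>\<phi> \<in> A\<close> by (simp add: N_def charts_at_def eq)
    show "((snd \<phi> \<circ> c) has_vector_derivative u r) (at r within {p..q})" if "r \<in> N \<inter> {p..q}" for r
    proof (rule has_vector_derivative_transform)
      have "(snd \<phi> \<circ> c') differentiable (at r)"
        using sm that by simp
      then have "((snd \<phi> \<circ> c') has_vector_derivative u r) (at r)"
        by (simp add: u_def frechet_derivative_eq_vector_derivative vector_derivative_works)
      then show "((snd \<phi> \<circ> c') has_vector_derivative u r) (at r within {p..q})"
        by (rule has_vector_derivative_at_within)
    qed (use that eq in auto)
  qed
qed

lemma smooth_segment_velocity:
  assumes A: "smooth_atlas A" and c: "smooth_segment A p q c" and s: "s \<in> {p..q}"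
    and \<phi>: "\<phi> \<in> charts_at A (c s)"
    and u: "((snd \<phi> \<circ> c) has_vector_derivative u) (at s within {p..q})"
  shows "velocity A c {p..q} s = coord_vec A \<phi> (c s) u"
  using smooth_segment_continuous[OF c] s u
  by (intro velocity_eq_coord_vec[where c = c and s = s, OF A \<phi>] at_within_Icc_neq_bot smooth_segment_less[OF c])
    (simp_all add: continuous_on_eq_continuous_within)

lemma smooth_segment_velocity_in_tangent_space:
  assumes A: "smooth_atlas A" and c: "smooth_segment A p q c" and s: "s \<in> {p..q}"
  shows "velocity A c {p..q} s \<in> tangent_space A (c s)"
proof -
  obtain \<phi> where \<phi>: "\<phi> \<in> charts_at A (c s)" using charts_at_nonempty[OF A] .
  obtain u where "((snd \<phi> \<circ> c) has_vector_derivative u) (at s within {p..q})"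
    using smooth_segment_chart_derivative[OF c \<phi> is_chartD(1)[OF charts_atD(2)[OF A \<phi>]] s] s
    by (metis IntI)
  from smooth_segment_velocity[OF A c s \<phi> this] show ?thesis
    using coord_vec_in_tangent_space[OF A \<phi>] by simp
qed

lemma smooth_segment_shift:
  assumes A: "\<And>\<phi>. \<phi> \<in> A \<Longrightarrow> open (fst \<phi>)" and c: "smooth_segment A p q c"
  shows "smooth_segment A (p + r) (q + r) (\<lambda>s. c (s - r))"
proof -
  obtain \<epsilon> c' where \<epsilon>: "\<epsilon> > 0" and c': "smooth_curve A {p-\<epsilon><..<q+\<epsilon>} c'"
    and eq: "\<And>s. s \<in> {p..q} \<Longrightarrow> c' s = c s"
    using c by (auto simp: smooth_segment_def)
  have "smooth_curve A {p+r-\<epsilon><..<q+r+\<epsilon>} (\<lambda>s. c' (s - r))"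
    unfolding smooth_curve_def smooth_on_def
  proof (intro conjI ballI allI)
    show "continuous_on {p+r-\<epsilon><..<q+r+\<epsilon>} (\<lambda>s. c' (s - r))"
      using c' unfolding smooth_curve_def
      by (intro continuous_on_compose2[of "{p-\<epsilon><..<q+\<epsilon>}" c' _ "\<lambda>s. s - r"])
        (auto intro!: continuous_intros)
    fix \<phi> n
    assume "\<phi> \<in> A"
    define N where "N = {s\<in>{p-\<epsilon><..<q+\<epsilon>}. c' s \<in> fst \<phi>}"
    have "{p-\<epsilon><..<q+\<epsilon>} \<inter> c' -` fst \<phi> = N" by (auto simp: N_def)
    moreover have "open ({p-\<epsilon><..<q+\<epsilon>} \<inter> c' -` fst \<phi>)"
      using c' A[OF \<open>\<phi> \<in> A\<close>] by (intro continuous_open_preimage) (simp_all add: smooth_curve_def)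
    ultimately have "open N" by simp
    moreover have "Ck_on n N (snd \<phi> \<circ> c')"
      using c' \<open>\<phi> \<in> A\<close> unfolding smooth_curve_def N_def smooth_on_def by blast
    ultimately have "Ck_on n {s. - r + s \<in> N} (\<lambda>s. (snd \<phi> \<circ> c') (- r + s))"
      by (intro Ck_on_affine bounded_linear_ident)
    moreover have "{s. - r + s \<in> N} = {s \<in> {p+r-\<epsilon><..<q+r+\<epsilon>}. c' (s - r) \<in> fst \<phi>}"
      by (auto simp: N_def)
    moreover have "(\<lambda>s. (snd \<phi> \<circ> c') (- r + s)) = snd \<phi> \<circ> (\<lambda>s. c' (s - r))"
      by (simp add: fun_eq_iff)
    ultimately show "Ck_on n {s \<in> {p+r-\<epsilon><..<q+r+\<epsilon>}. c' (s - r) \<in> fst \<phi>} (snd \<phi> \<circ> (\<lambda>s. c' (s - r)))"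
      by simp
  qed
  then show ?thesis
    using smooth_segment_less[OF c] \<epsilon> eq unfolding smooth_segment_def
    by (intro conjI exI[of _ \<epsilon>] exI[of _ "\<lambda>s. c' (s - r)"]) auto
qed

text \<open>An equivalence is needed because \<open>vector_derivative\<close> is a choice operator: equal sets of
  derivatives yield equal choices, even where no derivative exists.\<close>
lemma has_vector_derivative_shift_iff:
  fixes f :: "real \<Rightarrow> 'b::real_normed_vector"
  shows "((\<lambda>s. f (s - r)) has_vector_derivative d) (at s within (\<lambda>s. s + r) ` T) \<longleftrightarrow>
    (f has_vector_derivative d) (at (s - r) within T)"
proof -
  have *: "((\<lambda>s. f (s - r)) has_vector_derivative d) (at s within (\<lambda>s. s + r) ` T)"
    if "(f has_vector_derivative d) (at (s - r) within T)"
    for f :: "real \<Rightarrow> 'b" and r s T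
  proof -
    have "((\<lambda>s. s - r) has_vector_derivative 1) (at s within (\<lambda>s. s + r) ` T)"
      by (auto intro!: derivative_eq_intros)
    from vector_diff_chain_within[OF this, of f d] that show ?thesis
      by (simp add: image_image o_def)
  qed
  show ?thesis
  proof
    assume "((\<lambda>s. f (s - r)) has_vector_derivative d) (at s within (\<lambda>s. s + r) ` T)"
    then have "((\<lambda>s. f (s - r)) has_vector_derivative d) (at (s - r - - r) within (\<lambda>s. s + r) ` T)"
      by simp
    from *[OF this] show "(f has_vector_derivative d) (at (s - r) within T)"
      by (simp add: image_image)
  qed (rule *)
qed

lemma velocity_shift:
  "velocity A (\<lambda>s. c (s - r)) ((\<lambda>s. s + r) ` T) s = velocity A c T (s - r)"
proof -
  have "snd \<phi> \<circ> (\<lambda>s. c (s - r)) = (\<lambda>s. (snd \<phi> \<circ> c) (s - r))" for \<phi> :: "('a, 'b) chart"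
    by (simp add: fun_eq_iff)
  then show ?thesis
    by (simp only: velocity_def vector_derivative_def has_vector_derivative_shift_iff)
qed

text \<open>Straight lines in charts link nearby points of the manifold. The set \<open>B\<close> is open, so the line
  runs a little beyond both endpoints inside \<open>B\<close>; this provides the smooth extension.\<close>
lemma smooth_segment_line:
  assumes A: "smooth_atlas A" and \<phi>: "\<phi> \<in> A"
    and B: "open B" "convex B" "B \<subseteq> snd \<phi> ` fst \<phi>" and uv: "u \<in> B" "v \<in> B"
  shows "smooth_segment A 0 1 (\<lambda>s. chart_inv \<phi> (u + s *\<^sub>R (v - u)))"
proof -
  let ?L = "\<lambda>s::real. u + s *\<^sub>R (v - u)"
  have contL: "continuous_on T ?L" for T by (intro continuous_intros)
  have chart: "is_chart \<phi>" using A \<phi> by (simp add: smooth_atlas_def)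
  have op: "open (?L -` B)" by (rule open_vimage[OF B(1) contL])
  have "0 \<in> ?L -` B" "1 \<in> ?L -` B" using uv by auto
  then obtain e0 e1 where e: "e0 > 0" "ball 0 e0 \<subseteq> ?L -` B" "e1 > 0" "ball 1 e1 \<subseteq> ?L -` B"
    using op open_contains_ball by metis
  define \<epsilon> where "\<epsilon> = min e0 e1"
  have \<epsilon>: "\<epsilon> > 0" "\<epsilon> \<le> e0" "\<epsilon> \<le> e1" using e by (simp_all add: \<epsilon>_def)
  have inB: "?L s \<in> B" if "s \<in> {0-\<epsilon><..<1+\<epsilon>}" for s
  proof -
    consider "s < 0" | "s > 1" | "0 \<le> s" "s \<le> 1" by linarith
    then show ?thesis
    proof cases
      case 1
      then have "s \<in> ball 0 e0" using that \<epsilon> by (simp add: dist_real_def)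
      then show ?thesis using e(2) by blast
    next
      case 2
      then have "s \<in> ball 1 e1" using that \<epsilon> by (simp add: dist_real_def)
      then show ?thesis using e(4) by blast
    next
      case 3
      then have "(1 - s) *\<^sub>R u + s *\<^sub>R v \<in> B" using B(2) uv by (simp add: convex_alt)
      then show ?thesis by (simp add: algebra_simps)
    qed
  qed
  have "smooth_curve A {0-\<epsilon><..<1+\<epsilon>} (\<lambda>s. chart_inv \<phi> (?L s))"
    unfolding smooth_curve_def smooth_on_def
  proof (intro conjI ballI allI)
    show "continuous_on {0-\<epsilon><..<1+\<epsilon>} (\<lambda>s. chart_inv \<phi> (?L s))"
      using inB B(3) by (intro continuous_on_compose2[OF is_chartD(5)[OF chart] contL]) blast
    fix \<psi> n
    assume \<psi>: "\<psi> \<in> A"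
    let ?J = "{s\<in>{0-\<epsilon><..<1+\<epsilon>}. chart_inv \<phi> (?L s) \<in> fst \<psi>}"
    have "Ck_on n (snd \<phi> ` (fst \<phi> \<inter> fst \<psi>)) (snd \<psi> \<circ> chart_inv \<phi>)"
      using A \<phi> \<psi> unfolding smooth_atlas_def smooth_on_def by blast
    moreover have "open (snd \<phi> ` (fst \<phi> \<inter> fst \<psi>))"
      using A \<psi> by (intro open_chart_image[OF chart] is_chartD(1)) (simp add: smooth_atlas_def)
    ultimately have "Ck_on n {s. u + s *\<^sub>R (v - u) \<in> snd \<phi> ` (fst \<phi> \<inter> fst \<psi>)}
        (\<lambda>s. (snd \<psi> \<circ> chart_inv \<phi>) (u + s *\<^sub>R (v - u)))"
      by (intro Ck_on_affine[OF _ bounded_linear_scaleR_left])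
    moreover have "?J \<subseteq> {s. u + s *\<^sub>R (v - u) \<in> snd \<phi> ` (fst \<phi> \<inter> fst \<psi>)}"
    proof
      fix s
      assume s: "s \<in> ?J"
      then have "?L s \<in> snd \<phi> ` fst \<phi>" using inB[of s] B(3) by auto
      then obtain x where x: "x \<in> fst \<phi>" "?L s = snd \<phi> x" by blast
      then have "x \<in> fst \<psi>" using s is_chartD(6)[OF chart x(1)] by simp
      then show "s \<in> {s. u + s *\<^sub>R (v - u) \<in> snd \<phi> ` (fst \<phi> \<inter> fst \<psi>)}" using x by auto
    qed
    ultimately have "Ck_on n ?J (\<lambda>s. (snd \<psi> \<circ> chart_inv \<phi>) (u + s *\<^sub>R (v - u)))"
      by (rule Ck_on_subset)
    then show "Ck_on n ?J (snd \<psi> \<circ> (\<lambda>s. chart_inv \<phi> (?L s)))"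
      by (simp add: o_def)
  qed
  then show ?thesis
    using \<epsilon> unfolding smooth_segment_def
    by (intro conjI exI[of _ \<epsilon>] exI[of _ "\<lambda>s. chart_inv \<phi> (?L s)"]) auto
qed

section \<open>Concatenation of curves\<close>

text \<open>Piecewise smooth curves and future-directed timelike curves have the same form, a subdivision
  whose pieces satisfy a condition \<open>Q\<close>; hence concatenation is proved only once.\<close>
definition piecewise :: "(real \<Rightarrow> real \<Rightarrow> (real \<Rightarrow> 'a) \<Rightarrow> bool) \<Rightarrow> real \<Rightarrow> real \<Rightarrow> (real \<Rightarrow> 'a) \<Rightarrow> bool" where
  "piecewise Q a b c \<longleftrightarrow> (\<exists>n p. subdivision a b n p \<and> (\<forall>i<n. Q (p i) (p (Suc i)) c))"

definition concat_at :: "real \<Rightarrow> real \<Rightarrow> (real \<Rightarrow> 'a) \<Rightarrow> (real \<Rightarrow> 'a) \<Rightarrow> real \<Rightarrow> 'a" where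
  "concat_at b r c d s = (if s \<le> b then c s else d (s - r))"

lemma piecewise_single: "p < q \<Longrightarrow> Q p q c \<Longrightarrow> piecewise Q p q c"
  unfolding piecewise_def subdivision_def
  by (intro exI[of _ 1] exI[of _ "\<lambda>i. if i = 0 then p else q"]) simp

lemma subdivision_mono:
  assumes "subdivision a b n p" and "i \<le> j" and "j \<le> n"
  shows "p i \<le> p j"
  using assms(2,3)
proof (induction j rule: dec_induct)
  case (step j)
  then have "p j < p (Suc j)" using assms(1) by (simp add: subdivision_def)
  then show ?case using step by simp
qed simp

lemma subdivision_less: "subdivision a b n p \<Longrightarrow> a < b"
  using subdivision_mono[of a b n p 1 n] unfolding subdivision_def
  by (metis One_nat_def Suc_leI le_refl order_less_le_trans)

lemma piecewise_less: "piecewise Q a b c \<Longrightarrow> a < b"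
  by (auto simp: piecewise_def dest: subdivision_less)

text \<open>Two properties of \<open>Q\<close> make this work: a piece depends on the curve only over its own interval,
  and it may be translated. The value at \<open>b\<close> comes from \<open>c\<close>, but \<open>c b = d a'\<close>, so the first piece
  of \<open>d\<close> is unaffected.\<close>
lemma piecewise_concat:
  assumes loc: "\<And>p q c d. (\<And>s. s \<in> {p..q} \<Longrightarrow> c s = d s) \<Longrightarrow> Q p q c \<Longrightarrow> Q p q d"
    and shift: "\<And>p q c r. Q p q c \<Longrightarrow> Q (p + r) (q + r) (\<lambda>s. c (s - r))"
    and c: "piecewise Q a b c" and d: "piecewise Q a' b' d" and eq: "c b = d a'"
  shows "piecewise Q a (b' + (b - a')) (concat_at b (b - a') c d)"
proof -
  obtain n p where p: "subdivision a b n p" and Qp: "\<And>i. i < n \<Longrightarrow> Q (p i) (p (Suc i)) c"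
    using c by (auto simp: piecewise_def)
  obtain n' p' where p': "subdivision a' b' n' p'" and Qp': "\<And>i. i < n' \<Longrightarrow> Q (p' i) (p' (Suc i)) d"
    using d by (auto simp: piecewise_def)
  define r where "r = b - a'"
  define P where "P i = (if i \<le> n then p i else p' (i - n) + r)" for i
  \<comment> \<open>at \<open>i = n\<close> both branches agree, since \<open>p n = b = p' 0 + r\<close>\<close>
  have P_ge: "P i = p' (i - n) + r" if "i \<ge> n" for i
    using that p p' by (cases "i = n") (auto simp: P_def subdivision_def r_def)
  have "subdivision a (b' + r) (n + n') P"
    unfolding subdivision_def
  proof (intro conjI allI impI)
    show "0 < n + n'" using p by (simp add: subdivision_def)
    show "P 0 = a" using p by (simp add: P_def subdivision_def)
    show "P (n + n') = b' + r" using p' by (simp add: P_ge subdivision_def)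
    show "P i < P (Suc i)" if "i < n + n'" for i
    proof (cases "i < n")
      case True
      then show ?thesis using p by (simp add: P_def subdivision_def)
    next
      case False
      then show ?thesis using that p' by (simp add: P_ge Suc_diff_le subdivision_def)
    qed
  qed
  moreover have "Q (P i) (P (Suc i)) (concat_at b r c d)" if "i < n + n'" for i
  proof (cases "i < n")
    case True
    have "p (Suc i) \<le> b"
      using subdivision_mono[OF p, of "Suc i" n] True p by (simp add: subdivision_def)
    then have "Q (p i) (p (Suc i)) (concat_at b r c d)"
      by (intro loc[OF _ Qp[OF True]]) (simp add: concat_at_def)
    then show ?thesis using True by (simp add: P_def)
  next
    case False
    define j where "j = i - n"
    have j: "j < n'" "P i = p' j + r" "P (Suc i) = p' (Suc j) + r"
      using False that by (simp_all add: j_def P_ge Suc_diff_le)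
    have "a' \<le> p' j" using subdivision_mono[OF p', of 0 j] j(1) p' by (simp add: subdivision_def)
    then have "d (s - r) = concat_at b r c d s" if "s \<in> {p' j + r..p' (Suc j) + r}" for s
      using that eq by (cases "s = b") (auto simp: concat_at_def r_def)
    then show ?thesis
      unfolding j(2,3) by (rule loc[OF _ shift[OF Qp'[OF j(1)]]])
  qed
  ultimately show ?thesis unfolding piecewise_def r_def by blast
qed

lemma piecewise_smooth_curve_eq: "piecewise_smooth_curve A = piecewise (smooth_segment A)"
  by (intro ext) (simp add: piecewise_smooth_curve_def piecewise_def)

lemma piecewise_smooth_curve_concat:
  assumes A: "\<And>\<phi>. \<phi> \<in> A \<Longrightarrow> open (fst \<phi>)"
    and c: "piecewise_smooth_curve A a b c" and d: "piecewise_smooth_curve A a' b' d"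
    and eq: "c b = d a'"
  shows "piecewise_smooth_curve A a (b' + (b - a')) (concat_at b (b - a') c d)"
  unfolding piecewise_smooth_curve_eq
proof (rule piecewise_concat)
  show "smooth_segment A p q d" if "\<And>s. s \<in> {p..q} \<Longrightarrow> c s = d s" "smooth_segment A p q c" for p q c d
    by (rule iffD1[OF smooth_segment_cong that(2)]) (rule that(1))
  show "smooth_segment A (p + r) (q + r) (\<lambda>s. c (s - r))" if "smooth_segment A p q c" for p q c r
    by (rule smooth_segment_shift[OF A that])
qed (use c d eq in \<open>simp_all add: piecewise_smooth_curve_eq\<close>)

definition timelike_segment where
  "timelike_segment A g X p q \<gamma> \<longleftrightarrow> smooth_segment A p q \<gamma> \<and>
     (\<forall>s\<in>{p..q}. future_timelike g X (\<gamma> s) (velocity A \<gamma> {p..q} s))"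

lemma future_timelike_curve_eq: "future_timelike_curve A g X = piecewise (timelike_segment A g X)"
  by (intro ext) (simp add: future_timelike_curve_def piecewise_def timelike_segment_def)

lemma velocity_cong:
  fixes A :: "('a, 'b::euclidean_space) chart set"
  assumes "\<And>r. r \<in> T \<Longrightarrow> c r = d r" and "s \<in> T"
  shows "velocity A c T s = velocity A d T s"
proof -
  have "((\<phi> \<circ> c) has_vector_derivative u) (at s within T) \<longleftrightarrow>
      ((\<phi> \<circ> d) has_vector_derivative u) (at s within T)" for \<phi> :: "'a \<Rightarrow> 'b" and u
    by (rule has_vector_derivative_cong_ev) (auto simp: assms)
  then have "vector_derivative (\<phi> \<circ> c) (at s within T) = vector_derivative (\<phi> \<circ> d) (at s within T)"
    for \<phi> :: "'a \<Rightarrow> 'b"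
    by (simp only: vector_derivative_def)
  then show ?thesis by (simp add: fun_eq_iff velocity_def assms)
qed

lemma chron_rel_trans:
  assumes A: "\<And>\<phi>. \<phi> \<in> A \<Longrightarrow> open (fst \<phi>)"
    and "chron_rel A g X x y" and "chron_rel A g X y z"
  shows "chron_rel A g X x z"
proof -
  obtain a b c where c: "future_timelike_curve A g X a b c" "c a = x" "c b = y"
    using assms(2) by (auto simp: chron_rel_def)
  obtain a' b' d where d: "future_timelike_curve A g X a' b' d" "d a' = y" "d b' = z"
    using assms(3) by (auto simp: chron_rel_def)
  have "future_timelike_curve A g X a (b' + (b - a')) (concat_at b (b - a') c d)"
    unfolding future_timelike_curve_eq
  proof (rule piecewise_concat)
    show "piecewise (timelike_segment A g X) a b c" "piecewise (timelike_segment A g X) a' b' d"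
      using c(1) d(1) by (simp_all add: future_timelike_curve_eq)
    show "c b = d a'" using c d by simp
    show "timelike_segment A g X p q d"
      if eq: "\<And>s. s \<in> {p..q} \<Longrightarrow> c s = d s" and "timelike_segment A g X p q c" for p q c d
    proof -
      have "velocity A c {p..q} s = velocity A d {p..q} s" if "s \<in> {p..q}" for s
        by (rule velocity_cong[OF eq that])
      moreover have "smooth_segment A p q c \<longleftrightarrow> smooth_segment A p q d"
        by (rule smooth_segment_cong[OF eq])
      ultimately show ?thesis using that(2) eq by (simp add: timelike_segment_def)
    qed
    show "timelike_segment A g X (p + r) (q + r) (\<lambda>s. c (s - r))"
      if "timelike_segment A g X p q c" for p q c r
    proof -
      have "velocity A (\<lambda>s. c (s - r)) {p + r..q + r} s = velocity A c {p..q} (s - r)" for s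
        using velocity_shift[of A c r "{p..q}"] by (simp add: add.commute)
      then show ?thesis
        using that smooth_segment_shift[OF A] unfolding timelike_segment_def by simp
    qed
  qed
  moreover have "concat_at b (b - a') c d a = x" "concat_at b (b - a') c d (b' + (b - a')) = z"
    using c d piecewise_less[OF c(1)[unfolded future_timelike_curve_eq]]
      piecewise_less[OF d(1)[unfolded future_timelike_curve_eq]]
    by (auto simp: concat_at_def)
  ultimately show ?thesis unfolding chron_rel_def by blast
qed

lemma chron_rel_segment:
  assumes "timelike_segment A g X p q \<gamma>"
  shows "chron_rel A g X (\<gamma> p) (\<gamma> q)"
  unfolding chron_rel_def future_timelike_curve_eq
  using piecewise_single[of p q "timelike_segment A g X" \<gamma>] assms smooth_segment_less[of A p q \<gamma>]
  by (auto simp: timelike_segment_def)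

text \<open>The relation \<open>chron_rel\<close> is the transitive closure of the relation given by smooth timelike segments.\<close>
lemma chron_rel_induct:
  assumes "chron_rel A g X x y"
    and seg: "\<And>p q \<gamma>. timelike_segment A g X p q \<gamma> \<Longrightarrow> R (\<gamma> p) (\<gamma> q)"
    and trans: "\<And>x y z. R x y \<Longrightarrow> R y z \<Longrightarrow> R x z"
  shows "R x y"
proof -
  obtain n p \<gamma> a b where \<gamma>: "subdivision a b n p" "\<gamma> a = x" "\<gamma> b = y"
      "\<And>i. i < n \<Longrightarrow> timelike_segment A g X (p i) (p (Suc i)) \<gamma>"
    using assms(1) unfolding chron_rel_def future_timelike_curve_eq piecewise_def by blast
  have "R (\<gamma> (p 0)) (\<gamma> (p (Suc k)))" if "k < n" for k
    using that
  proof (induction k)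
    case (Suc k)
    then show ?case using trans seg[OF \<gamma>(4)[of "Suc k"]] by auto
  qed (use seg \<gamma>(4) in auto)
  from this[of "n - 1"] show ?thesis using \<gamma> by (simp add: subdivision_def)
qed

section \<open>The product atlas\<close>

text \<open>The charts of \<open>\<real> \<times> S\<close> are the cylinders over the charts of \<open>S\<close>, and the charts
  around a point of \<open>\<real> \<times> S\<close> correspond to those around its projection to \<open>S\<close>.\<close>
definition cyl_chart :: "('a, 'e) chart \<Rightarrow> (real \<times> 'a, real \<times> 'e) chart" where
  "cyl_chart \<psi> = (UNIV \<times> fst \<psi>, map_prod id (snd \<psi>))"

lemma SOM_atlas_eq: "SOM_atlas A = cyl_chart ` A"
proof -
  have eq: "{(UNIV, id)} \<times> A = Pair (UNIV, id) ` A" by auto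
  show ?thesis
    unfolding prod_atlas_def euclidean_atlas_def eq image_image cyl_chart_def[abs_def] by simp
qed

lemma charts_at_SOM: "charts_at (SOM_atlas A) z = cyl_chart ` charts_at A (snd z)"
  by (auto simp: charts_at_def SOM_atlas_eq cyl_chart_def mem_Times_iff)

lemma cyl_chart_regular:
  assumes "is_chart \<psi>"
  shows "open (fst (cyl_chart \<psi>))" and "inj_on (snd (cyl_chart \<psi>)) (fst (cyl_chart \<psi>))"
  using is_chartD(1,3)[OF assms] by (auto simp: cyl_chart_def open_Times intro!: map_prod_inj_on)

lemma SOM_atlas_open:
  assumes "smooth_atlas A" and "\<Phi> \<in> SOM_atlas A"
  shows "open (fst \<Phi>)"
  using assms cyl_chart_regular(1) by (auto simp: SOM_atlas_eq smooth_atlas_def)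

lemma cyl_chart_inv:
  assumes "is_chart \<psi>" and "y \<in> UNIV \<times> snd \<psi> ` fst \<psi>"
  shows "chart_inv (cyl_chart \<psi>) y = (fst y, chart_inv \<psi> (snd y))"
proof (rule inv_into_f_eq[OF cyl_chart_regular(2)[OF assms(1)]])
  show "(fst y, chart_inv \<psi> (snd y)) \<in> fst (cyl_chart \<psi>)"
    using assms(2) by (auto simp: cyl_chart_def mem_Times_iff intro: inv_into_into)
  show "snd (cyl_chart \<psi>) (fst y, chart_inv \<psi> (snd y)) = y"
    using assms(2) by (auto simp: cyl_chart_def f_inv_into_f)
qed

text \<open>For a curve \<open>\<gamma> = (t, c)\<close> in \<open>\<real> \<times> S\<close> the two components of the velocity are the derivative of
  \<open>t\<close> and the velocity of \<open>c\<close>. Both are instances of the naturality of velocities, because in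
  cylinder charts the projections are \<open>fst\<close> and \<open>snd\<close> up to a coordinate change of \<open>S\<close>.\<close>
lemma
  assumes A: "smooth_atlas A" and s: "s \<in> T" "at s within T \<noteq> bot" "continuous (at s within T) \<gamma>"
    and d: "\<And>\<psi>. \<psi> \<in> charts_at A (snd (\<gamma> s)) \<Longrightarrow>
      \<exists>u. ((snd (cyl_chart \<psi>) \<circ> \<gamma>) has_vector_derivative u) (at s within T)"
  shows dt_velocity:
      "((fst \<circ> \<gamma>) has_vector_derivative dt A (\<gamma> s) (velocity (SOM_atlas A) \<gamma> T s)) (at s within T)"
    and dproj_velocity:
      "dproj A (\<gamma> s) (velocity (SOM_atlas A) \<gamma> T s) = velocity A (snd \<circ> \<gamma>) T s"
proof -
  have ne: "charts_at (SOM_atlas A) (\<gamma> s) \<noteq> {}"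
    using charts_at_nonempty[OF A, of "snd (\<gamma> s)"] by (auto simp: charts_at_SOM)
  have reg: "open (fst \<Phi>) \<and> inj_on (snd \<Phi>) (fst \<Phi>)" if \<Phi>: "\<Phi> \<in> charts_at (SOM_atlas A) (\<gamma> s)" for \<Phi>
  proof -
    obtain \<psi> where \<psi>: "\<psi> \<in> charts_at A (snd (\<gamma> s))" "\<Phi> = cyl_chart \<psi>"
      using \<Phi> unfolding charts_at_SOM by blast
    show ?thesis unfolding \<psi>(2) using cyl_chart_regular[OF charts_atD(2)[OF A \<psi>(1)]] by blast
  qed
  have d': "\<exists>u. ((snd \<Phi> \<circ> \<gamma>) has_vector_derivative u) (at s within T)"
    if "\<Phi> \<in> charts_at (SOM_atlas A) (\<gamma> s)" for \<Phi>
    using that d by (auto simp: charts_at_SOM)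
  have diff: "(k \<circ> chart_inv \<Phi>) differentiable (at (snd \<Phi> (\<gamma> s)))"
    if \<psi>: "\<psi> \<in> charts_at A (snd (\<gamma> s))" "\<Phi> = cyl_chart \<psi>"
      and k: "\<And>y. y \<in> UNIV \<times> snd \<psi> ` fst \<psi> \<Longrightarrow> k (fst y, chart_inv \<psi> (snd y)) = K y"
        "(K has_derivative K') (at (snd \<Phi> (\<gamma> s)))"
    for \<psi> \<Phi> and k :: "real \<times> 'a \<Rightarrow> 'c::real_normed_vector" and K K'
  proof -
    note ch = is_chartD[OF charts_atD(2)[OF A \<psi>(1)]]
    have "((k \<circ> chart_inv \<Phi>) has_derivative K') (at (snd \<Phi> (\<gamma> s)))"
    proof (rule has_derivative_transform_within_open[OF k(2)])
      show "open (UNIV \<times> snd \<psi> ` fst \<psi>)" by (intro open_Times open_UNIV ch(2))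
      show "snd \<Phi> (\<gamma> s) \<in> UNIV \<times> snd \<psi> ` fst \<psi>"
        using charts_atD(3)[OF A \<psi>(1)] by (auto simp: \<psi>(2) cyl_chart_def mem_Times_iff)
      show "K y = (k \<circ> chart_inv \<Phi>) y" if "y \<in> UNIV \<times> snd \<psi> ` fst \<psi>" for y
        using k(1)[OF that] by (simp add: \<psi>(2) cyl_chart_inv[OF charts_atD(2)[OF A \<psi>(1)] that])
    qed
    then show ?thesis by (auto simp: differentiable_def)
  qed
  have "tangent_map (SOM_atlas A) euclidean_atlas fst (\<gamma> s) (velocity (SOM_atlas A) \<gamma> T s) =
      velocity euclidean_atlas (fst \<circ> \<gamma>) T s"
  proof (rule tangent_map_velocity[OF ne reg s d'])
    fix \<Phi> and \<theta> :: "(real, real) chart"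
    assume \<Phi>: "\<Phi> \<in> charts_at (SOM_atlas A) (\<gamma> s)"
      and "\<theta> \<in> charts_at euclidean_atlas (fst (\<gamma> s))"
    then have \<theta>: "snd \<theta> = id" by (auto simp: charts_at_def euclidean_atlas_def)
    obtain \<psi> where \<psi>: "\<psi> \<in> charts_at A (snd (\<gamma> s))" "\<Phi> = cyl_chart \<psi>"
      using \<Phi> unfolding charts_at_SOM by blast
    show "(snd \<theta> \<circ> fst \<circ> chart_inv \<Phi>) differentiable (at (snd \<Phi> (\<gamma> s)))"
      by (rule diff[OF \<psi>, of _ fst fst])
        (simp_all add: \<theta> bounded_linear_imp_has_derivative bounded_linear_fst)
  qed
  then have dt: "dt A (\<gamma> s) (velocity (SOM_atlas A) \<gamma> T s) = vector_derivative (fst \<circ> \<gamma>) (at s within T)"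
    by (simp add: dt_def velocity_def charts_at_def euclidean_atlas_def)
  obtain \<psi> where "\<psi> \<in> charts_at A (snd (\<gamma> s))" using charts_at_nonempty[OF A] .
  then obtain u where "((snd (cyl_chart \<psi>) \<circ> \<gamma>) has_vector_derivative u) (at s within T)"
    using d by blast
  then have "((\<lambda>r. fst ((snd (cyl_chart \<psi>) \<circ> \<gamma>) r)) has_vector_derivative fst u) (at s within T)"
    by (rule bounded_linear.has_vector_derivative[OF bounded_linear_fst])
  then have fst: "((fst \<circ> \<gamma>) has_vector_derivative fst u) (at s within T)"
    by (simp add: o_def cyl_chart_def)
  show "((fst \<circ> \<gamma>) has_vector_derivative dt A (\<gamma> s) (velocity (SOM_atlas A) \<gamma> T s)) (at s within T)"
    unfolding dt using fst vector_derivative_within[OF s(2) fst] by simp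
  show "dproj A (\<gamma> s) (velocity (SOM_atlas A) \<gamma> T s) = velocity A (snd \<circ> \<gamma>) T s"
    unfolding dproj_def
  proof (rule tangent_map_velocity[OF ne reg s d'])
    fix \<Phi> \<theta>
    assume "\<Phi> \<in> charts_at (SOM_atlas A) (\<gamma> s)" and \<theta>: "\<theta> \<in> charts_at A (snd (\<gamma> s))"
    then obtain \<psi> where \<psi>: "\<psi> \<in> charts_at A (snd (\<gamma> s))" "\<Phi> = cyl_chart \<psi>"
      by (auto simp: charts_at_SOM)
    have *: "snd (snd \<Phi> (\<gamma> s)) = snd \<psi> (snd (\<gamma> s))" by (simp add: \<psi> cyl_chart_def)
    show "(snd \<theta> \<circ> snd \<circ> chart_inv \<Phi>) differentiable (at (snd \<Phi> (\<gamma> s)))"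
    proof (rule diff[OF \<psi>])
      show "((\<lambda>y. (snd \<theta> \<circ> chart_inv \<psi>) (snd y)) has_derivative
        (\<lambda>v. frechet_derivative (snd \<theta> \<circ> chart_inv \<psi>) (at (snd \<psi> (snd (\<gamma> s)))) (snd v)))
          (at (snd \<Phi> (\<gamma> s)))"
      proof (rule has_derivative_compose[where f = snd and f' = snd])
        show "(snd has_derivative snd) (at (snd \<Phi> (\<gamma> s)))"
          by (rule bounded_linear_imp_has_derivative[OF bounded_linear_snd])
        show "((snd \<theta> \<circ> chart_inv \<psi>) has_derivative
            frechet_derivative (snd \<theta> \<circ> chart_inv \<psi>) (at (snd \<psi> (snd (\<gamma> s)))))
          (at (snd (snd \<Phi> (\<gamma> s))))"
          unfolding * by (rule transition_has_derivative[OF A \<psi>(1) \<theta>])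
      qed
    qed simp
  qed
qed

lemma
  assumes A: "smooth_atlas A" and \<gamma>: "smooth_segment (SOM_atlas A) p q \<gamma>"
  shows smooth_segment_snd: "smooth_segment A p q (snd \<circ> \<gamma>)"
    and smooth_segment_dt: "s \<in> {p..q} \<Longrightarrow>
      ((fst \<circ> \<gamma>) has_vector_derivative dt A (\<gamma> s) (velocity (SOM_atlas A) \<gamma> {p..q} s))
        (at s within {p..q})"
    and smooth_segment_dproj: "s \<in> {p..q} \<Longrightarrow>
      dproj A (\<gamma> s) (velocity (SOM_atlas A) \<gamma> {p..q} s) = velocity A (snd \<circ> \<gamma>) {p..q} s"
proof -
  obtain \<epsilon> \<gamma>' where \<epsilon>: "\<epsilon> > 0" and \<gamma>': "smooth_curve (SOM_atlas A) {p-\<epsilon><..<q+\<epsilon>} \<gamma>'"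
    and eq: "\<And>s. s \<in> {p..q} \<Longrightarrow> \<gamma>' s = \<gamma> s"
    using \<gamma> by (auto simp: smooth_segment_def)
  let ?J = "{p-\<epsilon><..<q+\<epsilon>}"
  have "smooth_curve A ?J (snd \<circ> \<gamma>')"
    unfolding smooth_curve_def smooth_on_def
  proof (intro conjI ballI allI)
    show "continuous_on ?J (snd \<circ> \<gamma>')"
      using \<gamma>' by (simp add: smooth_curve_def o_def continuous_on_snd)
    fix \<psi> n
    assume "\<psi> \<in> A"
    then have \<Psi>: "cyl_chart \<psi> \<in> SOM_atlas A" by (simp add: SOM_atlas_eq)
    have "?J \<inter> \<gamma>' -` fst (cyl_chart \<psi>) = {s\<in>?J. \<gamma>' s \<in> fst (cyl_chart \<psi>)}" by auto
    moreover have "open (?J \<inter> \<gamma>' -` fst (cyl_chart \<psi>))"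
      using \<gamma>' SOM_atlas_open[OF A \<Psi>]
      by (intro continuous_open_preimage) (simp_all add: smooth_curve_def)
    ultimately have op: "open {s\<in>?J. \<gamma>' s \<in> fst (cyl_chart \<psi>)}" by simp
    have "Ck_on n {s\<in>?J. \<gamma>' s \<in> fst (cyl_chart \<psi>)} (snd (cyl_chart \<psi>) \<circ> \<gamma>')"
      using \<gamma>' \<Psi> unfolding smooth_curve_def smooth_on_def by blast
    from Ck_on_bounded_linear[OF op bounded_linear_snd this]
    show "Ck_on n {s\<in>?J. (snd \<circ> \<gamma>') s \<in> fst \<psi>} (snd \<psi> \<circ> (snd \<circ> \<gamma>'))"
      by (simp add: cyl_chart_def mem_Times_iff o_def)
  qed
  then show "smooth_segment A p q (snd \<circ> \<gamma>)"
    using smooth_segment_less[OF \<gamma>] \<epsilon> eq unfolding smooth_segment_def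
    by (intro conjI exI[of _ \<epsilon>] exI[of _ "snd \<circ> \<gamma>'"]) auto
  assume s: "s \<in> {p..q}"
  have 1: "at s within {p..q} \<noteq> bot" "continuous (at s within {p..q}) \<gamma>"
    using s at_within_Icc_neq_bot[OF smooth_segment_less[OF \<gamma>]] smooth_segment_continuous[OF \<gamma>]
    by (auto simp: continuous_on_eq_continuous_within)
  have 2: "\<exists>u. ((snd (cyl_chart \<psi>) \<circ> \<gamma>) has_vector_derivative u) (at s within {p..q})"
    if "\<psi> \<in> charts_at A (snd (\<gamma> s))" for \<psi>
  proof -
    have "cyl_chart \<psi> \<in> charts_at (SOM_atlas A) (\<gamma> s)" using that by (simp add: charts_at_SOM)
    then show ?thesis
      using smooth_segment_chart_derivative[OF \<gamma> _ cyl_chart_regular(1)[OF charts_atD(2)[OF A that]] s] s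
      by (metis IntI)
  qed
  show "((fst \<circ> \<gamma>) has_vector_derivative dt A (\<gamma> s) (velocity (SOM_atlas A) \<gamma> {p..q} s))
        (at s within {p..q})"
    by (rule dt_velocity[OF A s 1 2])
  show "dproj A (\<gamma> s) (velocity (SOM_atlas A) \<gamma> {p..q} s) = velocity A (snd \<circ> \<gamma>) {p..q} s"
    by (rule dproj_velocity[OF A s 1 2])
qed

lemma smooth_segment_Pair:
  assumes A: "smooth_atlas A" and c: "smooth_segment A p q c" and H: "real_polynomial_function H"
  shows "smooth_segment (SOM_atlas A) p q (\<lambda>s. (H s, c s))"
proof -
  obtain \<epsilon> c' where \<epsilon>: "\<epsilon> > 0" and c': "smooth_curve A {p-\<epsilon><..<q+\<epsilon>} c'"
    and eq: "\<And>s. s \<in> {p..q} \<Longrightarrow> c' s = c s"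
    using c by (auto simp: smooth_segment_def)
  let ?J = "{p-\<epsilon><..<q+\<epsilon>}"
  have "smooth_curve (SOM_atlas A) ?J (\<lambda>s. (H s, c' s))"
    unfolding smooth_curve_def smooth_on_def
  proof (intro conjI ballI allI)
    show "continuous_on ?J (\<lambda>s. (H s, c' s))"
      using c' Ck_on_real_polynomial[OF _ H, of ?J 0]
      by (intro continuous_on_Pair) (simp_all add: smooth_curve_def)
    fix \<Psi> n
    assume "\<Psi> \<in> SOM_atlas A"
    then obtain \<psi> where \<psi>: "\<psi> \<in> A" "\<Psi> = cyl_chart \<psi>" by (auto simp: SOM_atlas_eq)
    then have "open (fst \<psi>)" using A by (simp add: smooth_atlas_def is_chart_def)
    have "?J \<inter> c' -` fst \<psi> = {s\<in>?J. c' s \<in> fst \<psi>}" by auto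
    moreover have "open (?J \<inter> c' -` fst \<psi>)"
      using c' \<open>open (fst \<psi>)\<close>
      by (intro continuous_open_preimage) (simp_all add: smooth_curve_def)
    ultimately have op: "open {s\<in>?J. c' s \<in> fst \<psi>}" by simp
    have "Ck_on n {s\<in>?J. c' s \<in> fst \<psi>} (snd \<psi> \<circ> c')"
      using c' \<psi> unfolding smooth_curve_def smooth_on_def by blast
    from Ck_on_Pair[OF op Ck_on_real_polynomial[OF op H] this]
    show "Ck_on n {s\<in>?J. (H s, c' s) \<in> fst \<Psi>} (snd \<Psi> \<circ> (\<lambda>s. (H s, c' s)))"
      by (simp add: \<psi> cyl_chart_def o_def)
  qed
  then show ?thesis
    using smooth_segment_less[OF c] \<epsilon> eq unfolding smooth_segment_def
    by (intro conjI exI[of _ \<epsilon>] exI[of _ "\<lambda>s. (H s, c' s)"]) auto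
qed

section \<open>Timelike vectors and the Fermat metric\<close>

text \<open>The algebra that ties the Fermat metric to the light cones. Completing the square,
  the first inequality says that \<open>x = \<tau> - w / b\<close> satisfies \<open>x\<^sup>2 > D\<close>, where \<open>D\<close> is the term under the
  root; the second one, \<open>x > 0\<close>, selects the branch \<open>x > sqrt D\<close>.\<close>
lemma quadratic_future_iff:
  fixes b w g \<tau> :: real
  assumes b: "b > 0" and D: "(1 / b\<^sup>2) * w\<^sup>2 + (1 / b) * g \<ge> 0"
  shows "- b * \<tau> * \<tau> + \<tau> * w + w * \<tau> + g < 0 \<and> - b * \<tau> + w < 0 \<longleftrightarrow>
    (1 / b) * w + sqrt ((1 / b\<^sup>2) * w\<^sup>2 + (1 / b) * g) < \<tau>"
proof -
  define D where "D = (1 / b\<^sup>2) * w\<^sup>2 + (1 / b) * g"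
  define x where "x = \<tau> - (1 / b) * w"
  have "- b * \<tau> * \<tau> + \<tau> * w + w * \<tau> + g = b * (D - x\<^sup>2)"
    using b by (simp add: D_def x_def power2_eq_square field_simps)
  then have 1: "- b * \<tau> * \<tau> + \<tau> * w + w * \<tau> + g < 0 \<longleftrightarrow> D < x\<^sup>2"
    using b by (simp add: mult_less_0_iff)
  have "- b * \<tau> + w = - (b * x)" using b by (simp add: x_def algebra_simps)
  then have 2: "- b * \<tau> + w < 0 \<longleftrightarrow> 0 < x" using b by (simp add: zero_less_mult_iff)
  have "D < x\<^sup>2 \<and> 0 < x \<longleftrightarrow> sqrt D < x"
  proof
    assume "D < x\<^sup>2 \<and> 0 < x"
    then show "sqrt D < x" using real_sqrt_less_mono[of D "x\<^sup>2"] by simp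
  next
    assume *: "sqrt D < x"
    have "0 \<le> sqrt D" using D by (simp add: D_def)
    then have "(sqrt D)\<^sup>2 < x\<^sup>2" using * by (intro power_strict_mono) simp_all
    moreover have "0 < x" using \<open>0 \<le> sqrt D\<close> * by (rule le_less_trans)
    ultimately show "D < x\<^sup>2 \<and> 0 < x" using D by (simp add: D_def)
  qed
  then show ?thesis using 1 2 by (simp add: x_def D_def less_diff_eq add.commute)
qed

lemma velocity_const: "velocity A (\<lambda>_. x) UNIV s = (\<lambda>_. 0)"
  by (simp add: velocity_def fun_eq_iff o_def)

context SOM_spacetime
begin

lemma omega_zero: "\<omega> x (\<lambda>_. 0) = 0"
  using omega linear_on_tangent_zero[OF atlas] unfolding one_form_def by blast

lemma g0_zero: "v \<in> tangent_space A x \<Longrightarrow> g\<^sub>0 x v (\<lambda>_. 0) = 0"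
  using g0 linear_on_tangent_zero[OF atlas] unfolding symmetric_tensor_def by blast

lemma g0_zero': "v \<in> tangent_space A x \<Longrightarrow> g\<^sub>0 x (\<lambda>_. 0) v = 0"
  using g0 g0_zero zero_in_tangent_space[OF atlas] unfolding symmetric_tensor_def by metis

lemma fermat_zero: "fermat \<beta> \<omega> g\<^sub>0 x (\<lambda>_. 0) = 0"
  using g0_zero[OF zero_in_tangent_space[OF atlas]] by (simp add: fermat_def omega_zero)

lemma fermat_discriminant_nonneg:
  assumes "v \<in> tangent_space A x"
  shows "(1 / (\<beta> x)\<^sup>2) * (\<omega> x v)\<^sup>2 + (1 / \<beta> x) * g\<^sub>0 x v v \<ge> 0"
proof (cases "v = (\<lambda>_. 0)")
  case True
  then show ?thesis using g0_zero[OF assms] by (simp add: omega_zero)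
next
  case False
  have "(1 / (\<beta> x)\<^sup>2) * (\<omega> x v)\<^sup>2 + (1 / \<beta> x) * g\<^sub>0 x v v =
      (1 / \<beta> x) * (g\<^sub>0 x v v + (1 / \<beta> x) * (\<omega> x v)\<^sup>2)"
    by (simp add: algebra_simps power2_eq_square)
  also have "\<dots> \<ge> 0" using pos[OF assms False] beta_pos[of x] by simp
  finally show ?thesis .
qed

lemma del_t_components:
  shows dt_del_t: "dt A z (del_t A z) = 1" and dproj_del_t: "dproj A z (del_t A z) = (\<lambda>_. 0)"
proof -
  let ?\<gamma> = "\<lambda>t. (t, snd z)"
  have z: "?\<gamma> (fst z) = z" by simp
  have c: "continuous (at (fst z)) ?\<gamma>" by (intro continuous_intros)
  have d: "\<exists>u. ((snd (cyl_chart \<psi>) \<circ> ?\<gamma>) has_vector_derivative u) (at (fst z))" for \<psi> :: "('a, 'e) chart"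
  proof -
    have "((\<lambda>t::real. (t, snd \<psi> (snd z))) has_vector_derivative (1, 0)) (at (fst z))"
      by (intro has_vector_derivative_Pair has_vector_derivative_id has_vector_derivative_const)
    then show ?thesis by (auto simp: cyl_chart_def o_def)
  qed
  have "((fst \<circ> ?\<gamma>) has_vector_derivative dt A z (del_t A z)) (at (fst z))"
    using dt_velocity[OF atlas, of "fst z" UNIV ?\<gamma>] c d by (simp add: del_t_def)
  moreover have "((fst \<circ> ?\<gamma>) has_vector_derivative 1) (at (fst z))"
    by (simp add: o_def has_vector_derivative_id)
  ultimately show "dt A z (del_t A z) = 1" by (rule vector_derivative_unique_at)
  have "dproj A z (del_t A z) = velocity A (snd \<circ> ?\<gamma>) UNIV (fst z)"
    using dproj_velocity[OF atlas, of "fst z" UNIV ?\<gamma>] c d by (simp add: del_t_def)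
  then show "dproj A z (del_t A z) = (\<lambda>_. 0)" by (simp add: o_def velocity_const)
qed

text \<open>A vector \<open>(\<tau>, v)\<close> is timelike and future-directed iff \<open>\<tau>\<close> exceeds the Fermat metric of \<open>v\<close>:
  the Fermat metric is the arrival time of light, and causality becomes a comparison of elapsed
  time with Fermat length.\<close>
lemma future_timelike_iff:
  assumes "dproj A z V \<in> tangent_space A (snd z)"
  shows "future_timelike (SOM_metric A \<beta> \<omega> g\<^sub>0) (del_t A) z V \<longleftrightarrow>
    fermat \<beta> \<omega> g\<^sub>0 (snd z) (dproj A z V) < dt A z V"
  using quadratic_future_iff[OF beta_pos fermat_discriminant_nonneg[OF assms], of "dt A z V"]
  by (simp add: future_timelike_def SOM_metric_def fermat_def dt_del_t dproj_del_t omega_zero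
      g0_zero'[OF assms])

text \<open>Locally the integrand is an explicit expression in the coordinate velocity and the coefficient
  functions of \<open>\<beta>\<close>, \<open>\<omega>\<close> and \<open>g\<^sub>0\<close>, all of them continuous along the curve. The square root is
  continuous but not differentiable at \<open>0\<close>, so that nothing better than continuity can be expected
  where the velocity vanishes.\<close>
lemma fermat_continuous:
  assumes c: "smooth_segment A p q c"
  shows "continuous_on {p..q} (\<lambda>s. fermat \<beta> \<omega> g\<^sub>0 (c s) (velocity A c {p..q} s))"
  unfolding continuous_on_eq_continuous_within
proof
  fix s
  assume s: "s \<in> {p..q}"
  obtain \<phi> where \<phi>s: "\<phi> \<in> charts_at A (c s)" using charts_at_nonempty[OF atlas] .
  note chart = charts_atD(2)[OF atlas \<phi>s]
  have "\<phi> \<in> A" using charts_atD(1)[OF atlas \<phi>s] .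
  obtain N u where N: "open N" "s \<in> N" and u: "continuous_on N u"
    and \<phi>: "\<And>r. r \<in> N \<inter> {p..q} \<Longrightarrow> \<phi> \<in> charts_at A (c r)"
    and d: "\<And>r. r \<in> N \<inter> {p..q} \<Longrightarrow> ((snd \<phi> \<circ> c) has_vector_derivative u r) (at r within {p..q})"
    using smooth_segment_chart_derivative[OF c \<phi>s is_chartD(1)[OF chart] s] by metis
  let ?S = "N \<inter> {p..q}"
  let ?E = "coord_vec A \<phi>"
  define y where "y r = snd \<phi> (c r)" for r
  have c\<phi>: "c r \<in> fst \<phi>" if "r \<in> ?S" for r using charts_atD(3)[OF atlas \<phi>[OF that]] .
  have cont_c: "continuous_on ?S c"
    using smooth_segment_continuous[OF c] by (rule continuous_on_subset) simp
  have cont_u: "continuous_on ?S u" using u by (rule continuous_on_subset) simp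
  have cont_y: "continuous_on ?S y"
    unfolding y_def using c\<phi> by (intro continuous_on_compose2[OF is_chartD(4)[OF chart] cont_c]) blast
  \<comment> \<open>a continuous function of the coordinates is continuous along the curve\<close>
  have along: "continuous_on ?S (\<lambda>r. f (c r))"
    if "smooth_on (snd \<phi> ` fst \<phi>) (\<lambda>y. f (chart_inv \<phi> y))" for f :: "'a \<Rightarrow> real"
  proof -
    have "Ck_on 0 (snd \<phi> ` fst \<phi>) (\<lambda>y. f (chart_inv \<phi> y))"
      using that unfolding smooth_on_def by blast
    then have "continuous_on (snd \<phi> ` fst \<phi>) (\<lambda>y. f (chart_inv \<phi> y))" by simp
    then have "continuous_on ?S (\<lambda>r. f (chart_inv \<phi> (y r)))"
      by (rule continuous_on_compose2[OF _ cont_y]) (use c\<phi> in \<open>auto simp: y_def\<close>)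
    moreover have "chart_inv \<phi> (y r) = c r" if "r \<in> ?S" for r
      using is_chartD(6)[OF chart c\<phi>[OF that]] by (simp add: y_def)
    ultimately show ?thesis by (simp cong: continuous_on_cong_simp)
  qed
  have cont_\<beta>: "continuous_on ?S (\<lambda>r. \<beta> (c r))"
    using beta_smooth \<open>\<phi> \<in> A\<close> by (intro along) (simp add: smooth_function_def o_def)
  have cont_\<omega>: "continuous_on ?S (\<lambda>r. \<omega> (c r) (?E (c r) e))" for e
    using omega \<open>\<phi> \<in> A\<close> by (intro along[of "\<lambda>x. \<omega> x (?E x e)"]) (simp add: one_form_def)
  have cont_g: "continuous_on ?S (\<lambda>r. g\<^sub>0 (c r) (?E (c r) e) (?E (c r) e'))" for e e'
    using g0 \<open>\<phi> \<in> A\<close>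
    by (intro along[of "\<lambda>x. g\<^sub>0 x (?E x e) (?E x e')"]) (simp add: symmetric_tensor_def)
  define W where "W r = (\<Sum>e\<in>Basis. (u r \<bullet> e) * \<omega> (c r) (?E (c r) e))" for r
  define G where "G r = (\<Sum>e\<in>Basis. (u r \<bullet> e) * (\<Sum>e'\<in>Basis. (u r \<bullet> e') *
      g\<^sub>0 (c r) (?E (c r) e) (?E (c r) e')))" for r
  have cont_W: "continuous_on ?S W"
    unfolding W_def by (intro continuous_intros cont_u cont_\<omega>)
  have cont_G: "continuous_on ?S G"
    unfolding G_def by (intro continuous_intros cont_u cont_g)
  have beta_nz: "\<beta> x \<noteq> 0" for x using beta_pos[of x] by simp
  have "continuous_on ?S (\<lambda>r. (1 / \<beta> (c r)) * W r +
      sqrt ((1 / (\<beta> (c r))\<^sup>2) * (W r)\<^sup>2 + (1 / \<beta> (c r)) * G r))"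
    by (intro continuous_intros cont_\<beta> cont_W cont_G) (simp_all add: beta_nz)
  moreover have "fermat \<beta> \<omega> g\<^sub>0 (c r) (velocity A c {p..q} r) = (1 / \<beta> (c r)) * W r +
      sqrt ((1 / (\<beta> (c r))\<^sup>2) * (W r)\<^sup>2 + (1 / \<beta> (c r)) * G r)" if r: "r \<in> ?S" for r
  proof -
    note coord = linear_on_tangent_coordinates[OF atlas \<phi>[OF r]]
    have lin: "linear_on_tangent A (c r) (\<omega> (c r))" "linear_on_tangent A (c r) (g\<^sub>0 (c r) (?E (c r) e))"
      and sym: "g\<^sub>0 (c r) (?E (c r) e) (?E (c r) e') = g\<^sub>0 (c r) (?E (c r) e') (?E (c r) e)" for e e'
      using omega g0 coord_vec_in_tangent_space[OF atlas \<phi>[OF r]]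
      unfolding one_form_def symmetric_tensor_def by blast+
    have "g\<^sub>0 (c r) (?E (c r) (u r)) (?E (c r) (u r)) =
        (\<Sum>e\<in>Basis. (u r \<bullet> e) * g\<^sub>0 (c r) (?E (c r) e) (?E (c r) (u r)))"
      unfolding coord[OF lin(2), of "u r" "u r"] by (intro sum.cong refl arg_cong2[of _ _ _ _ "(*)"] sym)
    also have "\<dots> = G r"
      unfolding G_def by (intro sum.cong refl arg_cong2[of _ _ _ _ "(*)"] coord[OF lin(2)])
    finally have "g\<^sub>0 (c r) (?E (c r) (u r)) (?E (c r) (u r)) = G r" .
    moreover have "\<omega> (c r) (?E (c r) (u r)) = W r" unfolding W_def by (rule coord[OF lin(1)])
    moreover have "velocity A c {p..q} r = ?E (c r) (u r)"
      using r by (intro smooth_segment_velocity[OF atlas c _ \<phi> d]) simp_all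
    ultimately show ?thesis by (simp add: fermat_def)
  qed
  ultimately have "continuous_on ?S (\<lambda>r. fermat \<beta> \<omega> g\<^sub>0 (c r) (velocity A c {p..q} r))"
    by (simp cong: continuous_on_cong_simp)
  then have "continuous (at s within ?S) (\<lambda>r. fermat \<beta> \<omega> g\<^sub>0 (c r) (velocity A c {p..q} r))"
    using s N(2) by (simp add: continuous_on_eq_continuous_within)
  moreover have "at s within ?S = at s within {p..q}"
    by (rule at_within_nhd[OF N(2,1)]) blast
  ultimately show "continuous (at s within {p..q}) (\<lambda>r. fermat \<beta> \<omega> g\<^sub>0 (c r) (velocity A c {p..q} r))"
    by simp
qed

section \<open>The Fermat length of piecewise smooth curves\<close>

text \<open>Two-sided velocities give an integrand that is independent of the interval. It differs from the
  one in \<open>fermat_length\<close> at most at the two endpoints, so the length becomes additive like any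
  integral.\<close>
definition speed :: "(real \<Rightarrow> 'a) \<Rightarrow> real \<Rightarrow> real" where
  "speed c s = fermat \<beta> \<omega> g\<^sub>0 (c s) (velocity A c UNIV s)"

abbreviation len :: "real \<Rightarrow> real \<Rightarrow> (real \<Rightarrow> 'a) \<Rightarrow> real" where
  "len \<equiv> fermat_length A \<beta> \<omega> g\<^sub>0"

lemma speed_has_integral_iff:
  "((\<lambda>s. fermat \<beta> \<omega> g\<^sub>0 (c s) (velocity A c {a..b} s)) has_integral y) {a..b} \<longleftrightarrow>
    (speed c has_integral y) {a..b}"
proof (rule has_integral_spike_finite_eq[of "{a, b}"])
  show "speed c s = fermat \<beta> \<omega> g\<^sub>0 (c s) (velocity A c {a..b} s)" if "s \<in> {a..b} - {a, b}" for s
  proof -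
    have "at s within {a..b} = at s" using that by (intro at_within_Icc_at) auto
    then show ?thesis unfolding speed_def velocity_def by (simp only:)
  qed
qed simp

lemma fermat_length_eq: "len a b c = integral {a..b} (speed c)"
  unfolding fermat_length_def integral_def integrable_on_def speed_has_integral_iff ..

lemma speed_integrable_segment:
  assumes "smooth_segment A p q c"
  shows "speed c integrable_on {p..q}"
  using integrable_continuous_real[OF fermat_continuous[OF assms]]
  unfolding integrable_on_def speed_has_integral_iff .

lemma fermat_length_sum:
  assumes p: "subdivision a b n p" "\<And>i. i < n \<Longrightarrow> smooth_segment A (p i) (p (Suc i)) c"
    and "k \<le> n"
  shows "speed c integrable_on {a..p k} \<and> len a (p k) c = (\<Sum>i<k. len (p i) (p (Suc i)) c)"
  using \<open>k \<le> n\<close>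
proof (induction k)
  case 0
  have "speed c integrable_on {a..a}"
    using integrable_on_refl[of "speed c" a] by (simp only: box_real)
  then show ?case using p(1) by (simp add: fermat_length_eq subdivision_def)
next
  case (Suc k)
  have le: "a \<le> p k" "p k \<le> p (Suc k)"
    using subdivision_mono[OF p(1), of 0 k] subdivision_mono[OF p(1), of k "Suc k"] Suc.prems p(1)
    by (auto simp: subdivision_def)
  have int: "speed c integrable_on {a..p (Suc k)}"
    using Suc speed_integrable_segment[OF p(2)[of k]]
    by (intro Henstock_Kurzweil_Integration.integrable_combine[OF le]) auto
  then show ?case
    using Henstock_Kurzweil_Integration.integral_combine[OF le int] Suc by (simp add: fermat_length_eq)
qed

lemma fermat_length_combine:
  assumes "piecewise_smooth_curve A a e c" and "a \<le> b" and "b \<le> e"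
  shows "len a e c = len a b c + len b e c"
proof -
  obtain n p where p: "subdivision a e n p" "\<And>i. i < n \<Longrightarrow> smooth_segment A (p i) (p (Suc i)) c"
    using assms(1) by (auto simp: piecewise_smooth_curve_def)
  have "speed c integrable_on {a..e}"
    using fermat_length_sum[OF p, of n] p(1) by (simp add: subdivision_def)
  from Henstock_Kurzweil_Integration.integral_combine[OF assms(2,3) this]
  show ?thesis by (simp add: fermat_length_eq)
qed

lemma fermat_length_cong:
  assumes "\<And>s. s \<in> {a..b} \<Longrightarrow> c s = d s"
  shows "len a b c = len a b d"
  unfolding fermat_length_def
proof (rule integral_cong)
  fix s
  assume s: "s \<in> {a..b}"
  show "fermat \<beta> \<omega> g\<^sub>0 (c s) (velocity A c {a..b} s) = fermat \<beta> \<omega> g\<^sub>0 (d s) (velocity A d {a..b} s)"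
    using velocity_cong[OF assms s, where A = A] assms[OF s] by simp
qed

lemma fermat_length_shift: "len (a + r) (b + r) (\<lambda>s. c (s - r)) = len a b c"
proof -
  let ?f = "\<lambda>s. fermat \<beta> \<omega> g\<^sub>0 (c s) (velocity A c {a..b} s)"
  have "velocity A (\<lambda>s. c (s - r)) {a + r..b + r} s = velocity A c {a..b} (s - r)" for s
    using velocity_shift[of A c r "{a..b}"] by (simp add: add.commute)
  then have "len (a + r) (b + r) (\<lambda>s. c (s - r)) = integral {a + r..b + r} (\<lambda>s. ?f (s - r))"
    by (simp add: fermat_length_def)
  also have "\<dots> = integral {a..b} ?f"
    using integral_shift_real_ivl[of "a + r" r "b + r" "\<lambda>s. ?f (s - r)"] by simp
  finally show ?thesis by (simp add: fermat_length_def)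
qed

text \<open>The set of all \<open>l\<close> with \<open>linked x y l\<close> is the one whose infimum is the pre-distance. Working with this
  relation reduces concatenation of curves to addition of numbers.\<close>
definition linked :: "'a \<Rightarrow> 'a \<Rightarrow> real \<Rightarrow> bool" where
  "linked x y l \<longleftrightarrow> (\<exists>a b c. piecewise_smooth_curve A a b c \<and> c a = x \<and> c b = y \<and> len a b c = l)"

lemma linked_segment:
  assumes "smooth_segment A p q c"
  shows "linked (c p) (c q) (len p q c)"
proof -
  have "piecewise_smooth_curve A p q c"
    unfolding piecewise_smooth_curve_eq
    by (rule piecewise_single[where Q = "smooth_segment A", OF smooth_segment_less[OF assms] assms])
  then show ?thesis unfolding linked_def by blast
qed

lemma linked_trans:
  assumes "linked x y l" and "linked y z m"
  shows "linked x z (l + m)"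
proof -
  obtain a b c where c: "piecewise_smooth_curve A a b c" "c a = x" "c b = y" "len a b c = l"
    using assms(1) by (auto simp: linked_def)
  obtain a' b' d where d: "piecewise_smooth_curve A a' b' d" "d a' = y" "d b' = z" "len a' b' d = m"
    using assms(2) by (auto simp: linked_def)
  define r where "r = b - a'"
  let ?e = "concat_at b r c d"
  have less: "a < b" "a' < b'"
    using piecewise_less[OF c(1)[unfolded piecewise_smooth_curve_eq]]
      piecewise_less[OF d(1)[unfolded piecewise_smooth_curve_eq]] .
  have op: "open (fst \<phi>)" if "\<phi> \<in> A" for \<phi>
    using that atlas by (simp add: smooth_atlas_def is_chart_def)
  have e: "piecewise_smooth_curve A a (b' + r) ?e"
    unfolding r_def using c(3) d(2) by (intro piecewise_smooth_curve_concat[OF op c(1) d(1)]) simp_all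
  have "len a (b' + r) ?e = len a b ?e + len b (b' + r) ?e"
    using less by (intro fermat_length_combine[OF e]) (simp_all add: r_def)
  also have "len a b ?e = len a b c"
    by (rule fermat_length_cong) (simp add: concat_at_def)
  also have "len b (b' + r) ?e = len (a' + r) (b' + r) (\<lambda>s. d (s - r))"
  proof -
    have "len b (b' + r) ?e = len b (b' + r) (\<lambda>s. d (s - r))"
      using c(3) d(2) by (intro fermat_length_cong) (auto simp: concat_at_def r_def)
    then show ?thesis by (simp add: r_def)
  qed
  also have "\<dots> = len a' b' d" by (rule fermat_length_shift)
  finally have "len a (b' + r) ?e = l + m" using c(4) d(4) by simp
  moreover have "?e a = x" "?e (b' + r) = z" using c d less by (auto simp: concat_at_def r_def)
  ultimately show ?thesis unfolding linked_def using e by blast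
qed

lemma linked_self: "linked x x 0"
proof -
  obtain \<phi> where \<phi>: "\<phi> \<in> charts_at A x" using charts_at_nonempty[OF atlas] .
  note chart = charts_atD(2)[OF atlas \<phi>]
  obtain e where "e > 0" "ball (snd \<phi> x) e \<subseteq> snd \<phi> ` fst \<phi>"
    using is_chartD(2)[OF chart] charts_atD(3)[OF atlas \<phi>] by (meson imageI open_contains_ball)
  then have "smooth_segment A 0 1 (\<lambda>s. chart_inv \<phi> (snd \<phi> x + s *\<^sub>R (snd \<phi> x - snd \<phi> x)))"
    by (intro smooth_segment_line[OF atlas charts_atD(1)[OF atlas \<phi>], of "ball (snd \<phi> x) e"]) simp_all
  then have "smooth_segment A 0 1 (\<lambda>_. x)"
    using is_chartD(6)[OF chart charts_atD(3)[OF atlas \<phi>]] by simp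
  moreover have "speed (\<lambda>_. x) = (\<lambda>_. 0)"
    by (simp add: fun_eq_iff speed_def velocity_const fermat_zero)
  ultimately show ?thesis using linked_segment[of 0 1 "\<lambda>_. x"] by (simp add: fermat_length_eq)
qed

text \<open>Being linked is an equivalence relation whose classes are open, because every point of a chart
  ball is linked to the centre by a straight line, traversed in either direction. So there is a
  single class on a connected manifold.\<close>
lemma linked_exists: "\<exists>l. linked x y l"
proof -
  have "(\<exists>l. linked x y l) \<and> (\<exists>l. linked y x l)"
  proof (rule connected_equivalence_relation[OF connected, of x y "\<lambda>x y. (\<exists>l. linked x y l) \<and> (\<exists>l. linked y x l)"])
    fix x
    obtain \<phi> where \<phi>: "\<phi> \<in> charts_at A x" using charts_at_nonempty[OF atlas] .
    note chart = charts_atD(2)[OF atlas \<phi>]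
    obtain e where e: "e > 0" "ball (snd \<phi> x) e \<subseteq> snd \<phi> ` fst \<phi>"
      using is_chartD(2)[OF chart] charts_atD(3)[OF atlas \<phi>] by (meson imageI open_contains_ball)
    define B where "B = ball (snd \<phi> x) e"
    have link: "\<exists>l. linked y z l" if "y \<in> fst \<phi>" "snd \<phi> y \<in> B" "z \<in> fst \<phi>" "snd \<phi> z \<in> B" for y z
    proof -
      have "smooth_segment A 0 1 (\<lambda>s. chart_inv \<phi> (snd \<phi> y + s *\<^sub>R (snd \<phi> z - snd \<phi> y)))"
        using that e(2)
        by (intro smooth_segment_line[OF atlas charts_atD(1)[OF atlas \<phi>], of B]) (simp_all add: B_def)
      from linked_segment[OF this] show ?thesis
        using is_chartD(6)[OF chart] that by auto
    qed
    have "open (fst \<phi> \<inter> snd \<phi> -` B)"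
      by (rule continuous_open_preimage[OF is_chartD(4,1)[OF chart]]) (simp add: B_def)
    moreover have "x \<in> fst \<phi> \<inter> snd \<phi> -` B" using charts_atD(3)[OF atlas \<phi>] e(1) by (simp add: B_def)
    ultimately show "\<exists>T. openin (top_of_set UNIV) T \<and> x \<in> T \<and>
        (\<forall>y\<in>T. (\<exists>l. linked x y l) \<and> (\<exists>l. linked y x l))"
      using link by (intro exI[of _ "fst \<phi> \<inter> snd \<phi> -` B"]) auto
  qed (use linked_trans in blast)+
  then show ?thesis by blast
qed

section \<open>Chronology in terms of Fermat length\<close>

abbreviation chron :: "real \<times> 'a \<Rightarrow> real \<times> 'a \<Rightarrow> bool" where
  "chron \<equiv> chron_rel (SOM_atlas A) (SOM_metric A \<beta> \<omega> g\<^sub>0) (del_t A)"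

text \<open>Along a timelike curve \<open>(t, c)\<close> the derivative of \<open>t\<close> exceeds the Fermat speed of \<open>c\<close>, hence the
  elapsed time exceeds the Fermat length. The conclusion is transitive, so smooth segments
  suffice.\<close>
lemma chron_imp_linked:
  assumes "chron z w"
  shows "\<exists>l. linked (snd z) (snd w) l \<and> l < fst w - fst z"
  using assms
proof (rule chron_rel_induct)
  fix p q \<gamma>
  assume "timelike_segment (SOM_atlas A) (SOM_metric A \<beta> \<omega> g\<^sub>0) (del_t A) p q \<gamma>"
  then have \<gamma>: "smooth_segment (SOM_atlas A) p q \<gamma>"
    and fut: "\<And>s. s \<in> {p..q} \<Longrightarrow> future_timelike (SOM_metric A \<beta> \<omega> g\<^sub>0) (del_t A) (\<gamma> s)
        (velocity (SOM_atlas A) \<gamma> {p..q} s)"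
    by (auto simp: timelike_segment_def)
  note c = smooth_segment_snd[OF atlas \<gamma>]
  have "integral {p..q} (\<lambda>s. fermat \<beta> \<omega> g\<^sub>0 ((snd \<circ> \<gamma>) s) (velocity A (snd \<circ> \<gamma>) {p..q} s))
      < (fst \<circ> \<gamma>) q - (fst \<circ> \<gamma>) p"
  proof (rule integral_less_increment[OF smooth_segment_less[OF \<gamma>] fermat_continuous[OF c]
        smooth_segment_dt[OF atlas \<gamma>]])
    fix s
    assume s: "s \<in> {p..q}"
    have tan: "dproj A (\<gamma> s) (velocity (SOM_atlas A) \<gamma> {p..q} s) \<in> tangent_space A (snd (\<gamma> s))"
      using smooth_segment_velocity_in_tangent_space[OF atlas c s] smooth_segment_dproj[OF atlas \<gamma> s]
      by simp
    show "fermat \<beta> \<omega> g\<^sub>0 ((snd \<circ> \<gamma>) s) (velocity A (snd \<circ> \<gamma>) {p..q} s)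
        < dt A (\<gamma> s) (velocity (SOM_atlas A) \<gamma> {p..q} s)"
      using fut[OF s] unfolding future_timelike_iff[OF tan] smooth_segment_dproj[OF atlas \<gamma> s]
      by simp
  qed
  then show "\<exists>l. linked (snd (\<gamma> p)) (snd (\<gamma> q)) l \<and> l < fst (\<gamma> q) - fst (\<gamma> p)"
    using linked_segment[OF c] unfolding fermat_length_def by auto
next
  fix x y z :: "real \<times> 'a"
  assume "\<exists>l. linked (snd x) (snd y) l \<and> l < fst y - fst x"
    and "\<exists>l. linked (snd y) (snd z) l \<and> l < fst z - fst y"
  then obtain l m where "linked (snd x) (snd y) l" "l < fst y - fst x"
    "linked (snd y) (snd z) m" "m < fst z - fst y" by blast
  then show "\<exists>l. linked (snd x) (snd z) l \<and> l < fst z - fst x"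
    by (intro exI[of _ "l + m"] conjI linked_trans) simp_all
qed

text \<open>Conversely, any time \<open>T\<close> longer than the Fermat length is realised by a timelike lift of \<open>c\<close>,
  whose time component is a polynomial growing faster than the Fermat speed.\<close>
lemma segment_imp_chron:
  assumes c: "smooth_segment A p q c" and T: "len p q c < T"
  shows "chron (t, c p) (t + T, c q)"
proof -
  note less = smooth_segment_less[OF c]
  obtain H h where H: "real_polynomial_function H" "\<And>x. (H has_real_derivative h x) (at x)"
    and h: "\<And>s. s \<in> {p..q} \<Longrightarrow> fermat \<beta> \<omega> g\<^sub>0 (c s) (velocity A c {p..q} s) < h s"
    and ends: "H p = t" "H q = t + T"
    using polynomial_rate_above[OF less fermat_continuous[OF c] T[unfolded fermat_length_def]] by metis
  define \<gamma> where "\<gamma> s = (H s, c s)" for s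
  have \<gamma>: "smooth_segment (SOM_atlas A) p q \<gamma>"
    unfolding \<gamma>_def by (rule smooth_segment_Pair[OF atlas c H(1)])
  have comp: "fst \<circ> \<gamma> = H" "snd \<circ> \<gamma> = c" by (simp_all add: \<gamma>_def fun_eq_iff)
  have "timelike_segment (SOM_atlas A) (SOM_metric A \<beta> \<omega> g\<^sub>0) (del_t A) p q \<gamma>"
    unfolding timelike_segment_def
  proof (intro conjI \<gamma> ballI)
    fix s
    assume s: "s \<in> {p..q}"
    let ?V = "velocity (SOM_atlas A) \<gamma> {p..q} s"
    have proj: "dproj A (\<gamma> s) ?V = velocity A c {p..q} s"
      using smooth_segment_dproj[OF atlas \<gamma> s] by (simp only: comp)
    then have tan: "dproj A (\<gamma> s) ?V \<in> tangent_space A (snd (\<gamma> s))"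
      using smooth_segment_velocity_in_tangent_space[OF atlas c s] by (simp add: \<gamma>_def)
    have "(H has_vector_derivative dt A (\<gamma> s) ?V) (at s within {p..q})"
      using smooth_segment_dt[OF atlas \<gamma> s] by (simp only: comp)
    moreover have "(H has_vector_derivative h s) (at s within {p..q})"
      by (rule has_vector_derivative_at_within[OF H(2)[of s,
              unfolded has_real_derivative_iff_has_vector_derivative]])
    ultimately have "dt A (\<gamma> s) ?V = h s"
      by (rule vector_derivative_unique_within[OF at_within_Icc_neq_bot[OF less s]])
    then show "future_timelike (SOM_metric A \<beta> \<omega> g\<^sub>0) (del_t A) (\<gamma> s) ?V"
      unfolding future_timelike_iff[OF tan] proj using h[OF s] by (simp add: \<gamma>_def)
  qed
  from chron_rel_segment[OF this] show ?thesis by (simp add: \<gamma>_def ends)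
qed

text \<open>The pieces of a curve are lifted one after the other. Each lift needs a little more time than the
  length of its piece, which the slack \<open>T - l\<close> pays for.\<close>
lemma linked_imp_chron:
  assumes "linked x y l" and "l < T"
  shows "chron (t, x) (t + T, y)"
proof -
  obtain a b c n p where c: "c a = x" "c b = y" "len a b c = l"
    and p: "subdivision a b n p" "\<And>i. i < n \<Longrightarrow> smooth_segment A (p i) (p (Suc i)) c"
    using assms(1) by (auto simp: linked_def piecewise_smooth_curve_def)
  have steps: "chron (t, c (p 0)) (t + T, c (p (Suc k)))"
    if "k < n" "(\<Sum>i<Suc k. len (p i) (p (Suc i)) c) < T" for k T
    using that
  proof (induction k arbitrary: T)
    case 0
    then show ?case using segment_imp_chron[OF p(2)[of 0]] by simp
  next
    case (Suc k)
    \<comment> \<open>the slack is shared between the last segment and the preceding ones\<close>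
    define d where "d = (T - (\<Sum>i<Suc (Suc k). len (p i) (p (Suc i)) c)) / 2"
    have d: "d > 0" using Suc.prems by (simp add: d_def)
    define T' where "T' = (\<Sum>i<Suc k. len (p i) (p (Suc i)) c) + d"
    have first: "chron (t, c (p 0)) (t + T', c (p (Suc k)))"
      using Suc.prems d by (intro Suc.IH) (simp_all add: T'_def)
    have last: "chron (t + T', c (p (Suc k))) (t + T' + (T - T'), c (p (Suc (Suc k))))"
      using d by (intro segment_imp_chron p(2) Suc.prems) (simp add: T'_def d_def field_simps)
    from chron_rel_trans[OF SOM_atlas_open[OF atlas] first last] show ?case by simp
  qed
  obtain m where m: "n = Suc m" using p(1) by (auto simp: subdivision_def gr0_conv_Suc)
  have "(\<Sum>i<Suc m. len (p i) (p (Suc i)) c) < T"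
    using fermat_length_sum[OF p, of n] p(1) c(3) assms(2) by (simp add: subdivision_def m)
  from steps[OF _ this] show ?thesis using c p(1) by (simp add: subdivision_def m)
qed

lemma chron_iff: "chron (t, x) (t', y) \<longleftrightarrow> (\<exists>l. linked x y l \<and> l < t' - t)"
proof
  assume "chron (t, x) (t', y)"
  from chron_imp_linked[OF this] show "\<exists>l. linked x y l \<and> l < t' - t" by simp
next
  assume "\<exists>l. linked x y l \<and> l < t' - t"
  then obtain l where "linked x y l" "l < t' - t" by blast
  from linked_imp_chron[OF this, of t] show "chron (t, x) (t', y)" by simp
qed

section \<open>The causality dichotomy\<close>

abbreviation dist\<^sub>F :: "'a \<Rightarrow> 'a \<Rightarrow> ereal" where
  "dist\<^sub>F \<equiv> fermat_dist A \<beta> \<omega> g\<^sub>0"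

lemma fermat_dist_less_iff: "dist\<^sub>F x y < r \<longleftrightarrow> (\<exists>l. linked x y l \<and> ereal l < r)"
  unfolding fermat_dist_def Inf_less_iff linked_def by blast

lemma chron_self_iff: "chron z z \<longleftrightarrow> dist\<^sub>F (snd z) (snd z) < 0"
  by (cases z) (simp add: chron_iff fermat_dist_less_iff)

lemma fermat_dist_self_le: "dist\<^sub>F x x \<le> 0"
proof -
  obtain a b c where c: "piecewise_smooth_curve A a b c" "c a = x" "c b = x" "len a b c = 0"
    using linked_self[of x] unfolding linked_def by blast
  then have "dist\<^sub>F x x \<le> ereal (len a b c)"
    unfolding fermat_dist_def by (intro Inf_lower) blast
  then show ?thesis using c(4) by (simp add: zero_ereal_def)
qed

lemma linked_iterate:
  assumes "linked x x l"
  shows "linked x x (real n * l)"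
proof (induction n)
  case (Suc n)
  from linked_trans[OF this assms] show ?case by (simp add: algebra_simps)
qed (simp add: linked_self)

text \<open>Travel from \<open>y\<close> to the loop, run through it as often as needed, and continue to \<open>z\<close>.\<close>
lemma negative_loop_imp_dist_minf:
  assumes "linked x x l" and "l < 0"
  shows "dist\<^sub>F y z = - \<infinity>"
proof (rule ereal_bot)
  fix B
  obtain l1 l2 where l12: "linked y x l1" "linked x z l2" using linked_exists by metis
  obtain n where n: "l1 + l2 - B < real n * (- l)"
    using reals_Archimedean3[of "- l"] assms(2) neg_0_less_iff_less by blast
  have "linked y z (l1 + real n * l + l2)"
    by (intro linked_trans[OF linked_trans[OF l12(1) linked_iterate[OF assms(1)]] l12(2)])
  then have "dist\<^sub>F y z < ereal B"
    unfolding fermat_dist_less_iff using n by (intro exI[of _ "l1 + real n * l + l2"]) simp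
  then show "dist\<^sub>F y z \<le> ereal B" by simp
qed

lemma negative_dist_imp_minf: "dist\<^sub>F x x < 0 \<Longrightarrow> dist\<^sub>F y z = - \<infinity>"
  using negative_loop_imp_dist_minf unfolding fermat_dist_less_iff by fastforce

lemma totally_vicious_iff:
  "totally_vicious (SOM_atlas A) (SOM_metric A \<beta> \<omega> g\<^sub>0) (del_t A) \<longleftrightarrow> (\<exists>x. dist\<^sub>F x x < 0)"
proof
  assume "totally_vicious (SOM_atlas A) (SOM_metric A \<beta> \<omega> g\<^sub>0) (del_t A)"
  then show "\<exists>x. dist\<^sub>F x x < 0" by (auto simp: totally_vicious_def chron_self_iff)
next
  assume "\<exists>x. dist\<^sub>F x x < 0"
  then show "totally_vicious (SOM_atlas A) (SOM_metric A \<beta> \<omega> g\<^sub>0) (del_t A)"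
    using negative_dist_imp_minf by (auto simp: totally_vicious_def chron_self_iff)
qed

lemma chronological_iff:
  "chronological (SOM_atlas A) (SOM_metric A \<beta> \<omega> g\<^sub>0) (del_t A) \<longleftrightarrow> (\<forall>x. dist\<^sub>F x x = 0)"
proof -
  have "\<not> dist\<^sub>F x x < 0 \<longleftrightarrow> dist\<^sub>F x x = 0" for x
    using fermat_dist_self_le[of x] by auto
  then show ?thesis by (simp add: chronological_def chron_self_iff)
qed

text \<open>A curve from \<open>x\<close> to \<open>y\<close> followed by one back is a loop at \<open>x\<close>. If the two pre-distances have a
  negative sum, curves nearly realising them form a loop of negative length; the case distinction
  accounts for the value \<open>-\<infinity>\<close>.\<close>
lemma negative_sym_dist_imp_negative_loop:
  assumes "fermat_sym_dist A \<beta> \<omega> g\<^sub>0 x y < 0"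
  shows "dist\<^sub>F x x < 0"
proof -
  have neg: "dist\<^sub>F x y + dist\<^sub>F y x < 0"
  proof (rule ccontr)
    assume "\<not> dist\<^sub>F x y + dist\<^sub>F y x < 0"
    then have "0 \<le> (1 / 2) * (dist\<^sub>F x y + dist\<^sub>F y x)"
      by (intro ereal_0_le_mult) simp_all
    then show False using assms by (simp add: fermat_sym_dist_def)
  qed
  have "dist\<^sub>F x y < \<infinity>" for x y
    unfolding fermat_dist_less_iff using linked_exists[of x y] by simp
  from this[of x y] this[of y x] obtain r s where rs: "dist\<^sub>F x y < ereal r" "dist\<^sub>F y x < ereal s" "r + s \<le> 0"
  proof (cases "dist\<^sub>F x y"; cases "dist\<^sub>F y x")
    fix u v assume uv: "dist\<^sub>F x y = ereal u" "dist\<^sub>F y x = ereal v"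
    define e where "e = - (u + v) / 2"
    have "e > 0" using neg by (simp add: uv e_def)
    then show thesis using uv by (intro that[of "u + e" "v + e"]) (auto simp: e_def)
  next
    fix u assume u: "dist\<^sub>F x y = ereal u" "dist\<^sub>F y x = - \<infinity>"
    then show thesis by (intro that[of "u + 1" "- (u + 1)"]) auto
  next
    fix v assume v: "dist\<^sub>F x y = - \<infinity>" "dist\<^sub>F y x = ereal v"
    then show thesis by (intro that[of "- (v + 1)" "v + 1"]) auto
  next
    assume "dist\<^sub>F x y = - \<infinity>" "dist\<^sub>F y x = - \<infinity>"
    then show thesis by (intro that[of 0 0]) auto
  qed auto
  then obtain l m where "linked x y l" "l < r" "linked y x m" "m < s"
    by (auto simp: fermat_dist_less_iff)
  then show ?thesis
    using linked_trans[of x y l x m] rs(3) unfolding fermat_dist_less_iff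
    by (intro exI[of _ "l + m"]) simp
qed

lemma chronological_iff_sym_dist:
  "(\<forall>x. dist\<^sub>F x x = 0) \<longleftrightarrow> (\<forall>x y. fermat_sym_dist A \<beta> \<omega> g\<^sub>0 x y \<ge> 0)"
proof
  assume "\<forall>x. dist\<^sub>F x x = 0"
  then show "\<forall>x y. fermat_sym_dist A \<beta> \<omega> g\<^sub>0 x y \<ge> 0"
    using negative_sym_dist_imp_negative_loop by (metis less_irrefl not_le)
next
  assume *: "\<forall>x y. fermat_sym_dist A \<beta> \<omega> g\<^sub>0 x y \<ge> 0"
  show "\<forall>x. dist\<^sub>F x x = 0"
  proof (rule ccontr)
    assume "\<not> (\<forall>x. dist\<^sub>F x x = 0)"
    then obtain x where "dist\<^sub>F x x < 0" using fermat_dist_self_le by (metis order_less_le)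
    then have "dist\<^sub>F x x = - \<infinity>" by (rule negative_dist_imp_minf)
    moreover have "(1 / 2 :: ereal) = ereal (1 / 2)" by (simp add: one_ereal_def)
    ultimately have "fermat_sym_dist A \<beta> \<omega> g\<^sub>0 x x < 0" by (simp add: fermat_sym_dist_def)
    then show False using *[rule_format, of x x] by simp
  qed
qed

end

theorem proposition3p8:
  fixes A :: "('a::{t2_space,second_countable_topology}, 'e::euclidean_space) chart set"
    and \<beta> :: "'a \<Rightarrow> real"
    and \<omega> :: "'a \<Rightarrow> ('a, 'e) tvec \<Rightarrow> real"
    and g\<^sub>0 :: "'a \<Rightarrow> ('a, 'e) tvec \<Rightarrow> ('a, 'e) tvec \<Rightarrow> real"
  assumes "SOM_spacetime A \<beta> \<omega> g\<^sub>0"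
  shows
    "((totally_vicious (SOM_atlas A) (SOM_metric A \<beta> \<omega> g\<^sub>0) (del_t A)
        \<longleftrightarrow> (\<exists>a b c. piecewise_smooth_curve A a b c \<and> c a = c b \<and>
               fermat_length A \<beta> \<omega> g\<^sub>0 a b c < 0)) \<and>
      (totally_vicious (SOM_atlas A) (SOM_metric A \<beta> \<omega> g\<^sub>0) (del_t A)
        \<longleftrightarrow> (\<exists>x. fermat_dist A \<beta> \<omega> g\<^sub>0 x x < 0)) \<and>
      (totally_vicious (SOM_atlas A) (SOM_metric A \<beta> \<omega> g\<^sub>0) (del_t A)
        \<longrightarrow> (\<forall>x y. fermat_dist A \<beta> \<omega> g\<^sub>0 x y = -\<infinity>)))
     \<and>
     ((chronological (SOM_atlas A) (SOM_metric A \<beta> \<omega> g\<^sub>0) (del_t A)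
        \<longleftrightarrow> (\<exists>x. fermat_dist A \<beta> \<omega> g\<^sub>0 x x = 0)) \<and>
      (chronological (SOM_atlas A) (SOM_metric A \<beta> \<omega> g\<^sub>0) (del_t A)
        \<longleftrightarrow> (\<forall>x. fermat_dist A \<beta> \<omega> g\<^sub>0 x x = 0)) \<and>
      (chronological (SOM_atlas A) (SOM_metric A \<beta> \<omega> g\<^sub>0) (del_t A)
        \<longleftrightarrow> (\<forall>x y. fermat_sym_dist A \<beta> \<omega> g\<^sub>0 x y \<ge> 0)))"
proof -
  interpret SOM_spacetime A \<beta> \<omega> g\<^sub>0 by (rule assms)
  have loop: "(\<exists>a b c. piecewise_smooth_curve A a b c \<and> c a = c b \<and> len a b c < 0) \<longleftrightarrow>
      (\<exists>x. dist\<^sub>F x x < 0)"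
  proof
    assume "\<exists>a b c. piecewise_smooth_curve A a b c \<and> c a = c b \<and> len a b c < 0"
    then obtain a b c where "piecewise_smooth_curve A a b c" "c a = c b" "len a b c < 0" by blast
    then have "linked (c a) (c a) (len a b c)" "ereal (len a b c) < 0"
      unfolding linked_def by (metis, simp)
    then show "\<exists>x. dist\<^sub>F x x < 0" unfolding fermat_dist_less_iff by blast
  next
    assume "\<exists>x. dist\<^sub>F x x < 0"
    then obtain x l where "linked x x l" "ereal l < 0" unfolding fermat_dist_less_iff by blast
    then show "\<exists>a b c. piecewise_smooth_curve A a b c \<and> c a = c b \<and> len a b c < 0"
      unfolding linked_def by (metis less_ereal.simps(1) zero_ereal_def)
  qed
  have all_zero: "(\<exists>x. dist\<^sub>F x x = 0) \<longleftrightarrow> (\<forall>x. dist\<^sub>F x x = 0)"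
  proof
    assume "\<exists>x. dist\<^sub>F x x = 0"
    then obtain x where x: "dist\<^sub>F x x = 0" ..
    show "\<forall>x. dist\<^sub>F x x = 0"
    proof (rule ccontr)
      assume "\<not> (\<forall>x. dist\<^sub>F x x = 0)"
      then obtain y where "dist\<^sub>F y y < 0" using fermat_dist_self_le by (metis order_less_le)
      then have "dist\<^sub>F x x = - \<infinity>" by (rule negative_dist_imp_minf)
      then show False using x by simp
    qed
  qed blast
  have minf: "(\<exists>x. dist\<^sub>F x x < 0) \<longrightarrow> (\<forall>x y. dist\<^sub>F x y = - \<infinity>)"
    using negative_dist_imp_minf by blast
  show ?thesis
    unfolding totally_vicious_iff chronological_iff loop all_zero
      chronological_iff_sym_dist[symmetric]
    using minf by blast
qed

end
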